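(* The RECURSION rule is a derived rule in the proof system $ABO1$. That is: let $(D\mid S)$ be a program with $D=\{P_i(\bar u_i)::S_i\mid i\in\{1,\dots,n\}\}$, let $I$ be an interpretation and $p,q,p_1,q_1,\dots,p_n,q_n$ assertions with $\{\bar u_i\}\cap free(q_i)=\emptyset$ for all $i$, and let $\Phi=\{\{p_i\}P_i(\bar u_i)\{q_i\}\mid i\in\{1,\dots,n\}\}$. If $\Phi\vdash_{ABO1,I}\{p\}S\{q\}$ and $\Phi\vdash_{ABO1,I}\{p_i\}S_i\{q_i\}$ for every $i\in\{1,\dots,n\}$, then $\vdash_{ABO1,I}\{p\}S\{q\}$.
   Context: Fix a first-order language $\mathcal L$; expressions are terms, Boolean expressions quantifier-free formulas, assertions formulas of $\mathcal L$. $free(p)$ is the set of free variables of $p$; $p[\bar x:=\bar t]$ is simultaneous substitution. Statements: $S ::= skip \mid \bar{x}:=\bar{t} \mid P(\bar{t}) \mid S;S \mid \mathbf{if}\ B\ \mathbf{then}\ S\ \mathbf{else}\ S\ \mathbf{fi} \mid \mathbf{while}\ B\ \mathbf{do}\ S\ \mathbf{od} \mid \mathbf{begin\ local}\ \bar{x}:=\bar{t};\ S\ \mathbf{end}$ (parallel assignment of expressions to distinct variables; calls with actual parameters; blocks with initialized local variables). A declaration $P(\bar u)::S$ has distinct formal parameters $\bar u$; a program $(D\mid S)$ has a set $D$ of declarations, exactly one for each procedure name occurring in it. A call $P(\bar t)$ is generic if $\bar t$ is the list $\bar u$ of formal parameters of $P$. $var(D\mid S)$ is the set of variables occurring in the program.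 $change$ is defined inductively: $change(D\mid skip)=\emptyset$; $change(D\mid\bar x:=\bar t)=\{\bar x\}$; $change(D\mid P(\bar t))=change(D)\setminus\{\bar u\}$ if $P(\bar u)::S\in D$ and $\emptyset$ otherwise; composition, conditional: union of the components; while: that of the body; $change(D\mid\mathbf{begin\ local}\ \bar x:=\bar t;\ S\ \mathbf{end})=change(D\mid S)\setminus\{\bar x\}$; $change(P(\bar u)::S)=change(\emptyset\mid S)$; $change(D)=\bigcup_{d\in D}change(d)$. $\Phi\vdash_{PS,I}\{p\}S\{q\}$ means $\{p\}S\{q\}$ is derivable in proof system $PS$ from assumptions $\Phi$, with all assertions true in $I$ usable as premises of CONSEQUENCE. The proof system $ABO$ consists of: SKIP $\{p\}skip\{p\}$; PARALLEL ASSIGNMENT $\{p[\bar x:=\bar t]\}\bar x:=\bar t\{p\}$; COMPOSITION: from $\{p\}S_1\{r\}$, $\{r\}S_2\{q\}$ infer $\{p\}S_1;S_2\{q\}$; CONDITIONAL: from $\{p\wedge B\}S_1\{q\}$, $\{p\wedge\neg B\}S_2\{q\}$ infer $\{p\}\mathbf{if}\ B\ \mathbf{then}\ S_1\ \mathbf{else}\ S_2\ \mathbf{fi}\{q\}$; LOOP: from $\{p\wedge B\}S\{p\}$ infer $\{p\}\mathbf{while}\ B\ \mathbf{do}\ S\ \mathbf{od}\{p\wedge\neg B\}$; BLOCK: from $\{p\}\bar x:=\bar t;S\{q\}$ infer $\{p\}\mathbf{begin\ local}\ \bar x:=\bar t;\ S\ \mathbf{end}\{q\}$ if $\{\bar x\}\cap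 free(q)=\emptyset$; SUBSTITUTION: from $\{p\}S\{q\}$ infer $\{p[\bar x:=\bar y]\}S\{q[\bar x:=\bar y]\}$ if $\{\bar x\}\cap var(D\mid S)=\emptyset$, $\{\bar y\}\cap change(D\mid S)=\emptyset$; INVARIANCE: from $\{r\}S\{q\}$ infer $\{p\wedge r\}S\{p\wedge q\}$ if $free(p)\cap change(D\mid S)=\emptyset$; $\exists$-INTRODUCTION: from $\{p\}S\{q\}$ infer $\{\exists\bar x:p\}S\{q\}$ if $\{\bar x\}\cap(var(D\mid S)\cup free(q))=\emptyset$; CONSEQUENCE: from $p\to p_1$, $\{p_1\}S\{q_1\}$, $q_1\to q$ infer $\{p\}S\{q\}$; RECURSION II: from $\Psi\vdash\{p\}S\{q\}$ and $\Psi\vdash\{p_i\}\mathbf{begin\ local}\ \bar u_i:=\bar t_i;\ S_i\ \mathbf{end}\{q_i\}$ for $i\in\{1,\dots,k\}$ infer $\{p\}S\{q\}$, where $\Psi=\{\{p_i\}P_i(\bar t_i)\{q_i\}\mid i\le k\}$, $P_1(\bar t_1),\dots,P_k(\bar t_k)$ are all procedure calls appearing in $(D\mid S)$, $P_i(\bar u_i)::S_i\in D$, and $\vdash$ denotes provability using the remaining axioms and rules. $ABO1$ is $ABO$ augmented with PROCEDURE CALL: from $\{p\}P(\bar u)\{q\}$ infer $\{p[\bar u:=\bar t]\}P(\bar t)\{q\}$, where $P(\bar u)::S\in D$ and $\{\bar u\}\cap free(q)=\emptyset$. The RECURSION rule: from $\Phi\vdash\{p\}S\{q\}$ and $\Phi\vdash\{p_i\}S_i\{q_i\}$,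 $i\le n$, infer $\{p\}S\{q\}$, where $\Phi=\{\{p_i\}P_i(\bar u_i)\{q_i\}\mid i\le n\}$, $D=\{P_i(\bar u_i)::S_i\mid i\le n\}$, $\{\bar u_i\}\cap free(q_i)=\emptyset$. *)

theory Defs
  imports Main
begin

section \<open>First-order languages with equality\<close>

type_synonym var = nat

datatype 'f tm = Var var | Fun 'f "'f tm list"

datatype ('f, 'r) fm =
    Eq "'f tm" "'f tm"
  | Rel 'r "'f tm list"
  | Neg "('f, 'r) fm"
  | And "('f, 'r) fm" "('f, 'r) fm"
  | Or "('f, 'r) fm" "('f, 'r) fm"
  | Imp "('f, 'r) fm" "('f, 'r) fm"
  | Ex var "('f, 'r) fm"
  | All var "('f, 'r) fm"

text \<open>A language lists its function and relation symbols together with their arities.\<close>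

record ('f, 'r) lang =
  funs :: "('f \<times> nat) set"
  rels :: "('r \<times> nat) set"

primrec is_expr :: "('f, 'r) lang \<Rightarrow> 'f tm \<Rightarrow> bool" where
  "is_expr L (Var x) = True"
| "is_expr L (Fun f ts) = ((f, length ts) \<in> funs L \<and> list_all (is_expr L) ts)"

primrec is_assn :: "('f, 'r) lang \<Rightarrow> ('f, 'r) fm \<Rightarrow> bool" where
  "is_assn L (Eq s t) = (is_expr L s \<and> is_expr L t)"
| "is_assn L (Rel r ts) = ((r, length ts) \<in> rels L \<and> list_all (is_expr L) ts)"
| "is_assn L (Neg p) = is_assn L p"
| "is_assn L (And p q) = (is_assn L p \<and> is_assn L q)"
| "is_assn L (Or p q) = (is_assn L p \<and> is_assn L q)"
| "is_assn L (Imp p q) = (is_assn L p \<and> is_assn L q)"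
| "is_assn L (Ex x p) = is_assn L p"
| "is_assn L (All x p) = is_assn L p"

primrec quantifier_free :: "('f, 'r) fm \<Rightarrow> bool" where
  "quantifier_free (Eq s t) = True"
| "quantifier_free (Rel r ts) = True"
| "quantifier_free (Neg p) = quantifier_free p"
| "quantifier_free (And p q) = (quantifier_free p \<and> quantifier_free q)"
| "quantifier_free (Or p q) = (quantifier_free p \<and> quantifier_free q)"
| "quantifier_free (Imp p q) = (quantifier_free p \<and> quantifier_free q)"
| "quantifier_free (Ex x p) = False"
| "quantifier_free (All x p) = False"

definition is_bexpr :: "('f, 'r) lang \<Rightarrow> ('f, 'r) fm \<Rightarrow> bool" where
  "is_bexpr L b \<longleftrightarrow> is_assn L b \<and> quantifier_free b"

primrec tvars :: "'f tm \<Rightarrow> var set" where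
  "tvars (Var x) = {x}"
| "tvars (Fun f ts) = \<Union> (set (map tvars ts))"

primrec free :: "('f, 'r) fm \<Rightarrow> var set" where
  "free (Eq s t) = tvars s \<union> tvars t"
| "free (Rel r ts) = \<Union> (set (map tvars ts))"
| "free (Neg p) = free p"
| "free (And p q) = free p \<union> free q"
| "free (Or p q) = free p \<union> free q"
| "free (Imp p q) = free p \<union> free q"
| "free (Ex x p) = free p - {x}"
| "free (All x p) = free p - {x}"

primrec tsubst :: "'f tm \<Rightarrow> (var \<Rightarrow> 'f tm) \<Rightarrow> 'f tm" where
  "tsubst (Var x) \<sigma> = \<sigma> x"
| "tsubst (Fun f ts) \<sigma> = Fun f (map (\<lambda>t. tsubst t \<sigma>) ts)"

text \<open>Capture-avoiding simultaneous substitution: a bound variable is renamed exactly when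
  it would capture a variable of a substituted term.\<close>

definition variant :: "var \<Rightarrow> var set \<Rightarrow> var" where
  "variant x V = (if x \<in> V then (LEAST z. z \<notin> V) else x)"

primrec subst :: "('f, 'r) fm \<Rightarrow> (var \<Rightarrow> 'f tm) \<Rightarrow> ('f, 'r) fm" where
  "subst (Eq s t) \<sigma> = Eq (tsubst s \<sigma>) (tsubst t \<sigma>)"
| "subst (Rel r ts) \<sigma> = Rel r (map (\<lambda>t. tsubst t \<sigma>) ts)"
| "subst (Neg p) \<sigma> = Neg (subst p \<sigma>)"
| "subst (And p q) \<sigma> = And (subst p \<sigma>) (subst q \<sigma>)"
| "subst (Or p q) \<sigma> = Or (subst p \<sigma>) (subst q \<sigma>)"
| "subst (Imp p q) \<sigma> = Imp (subst p \<sigma>) (subst q \<sigma>)"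
| "subst (Ex x p) \<sigma> =
     (let z = variant x (\<Union>y \<in> free p - {x}. tvars (\<sigma> y)) in Ex z (subst p (\<sigma>(x := Var z))))"
| "subst (All x p) \<sigma> =
     (let z = variant x (\<Union>y \<in> free p - {x}. tvars (\<sigma> y)) in All z (subst p (\<sigma>(x := Var z))))"

definition assign_subst :: "var list \<Rightarrow> 'f tm list \<Rightarrow> var \<Rightarrow> 'f tm" where
  "assign_subst xs ts x = (case map_of (zip xs ts) x of Some t \<Rightarrow> t | None \<Rightarrow> Var x)"

abbreviation substs :: "('f, 'r) fm \<Rightarrow> var list \<Rightarrow> 'f tm list \<Rightarrow> ('f, 'r) fm"
  ("_[_ :=\<^sub>s _]" [1000, 0, 0] 1000) where
  "p[xs :=\<^sub>s ts] \<equiv> subst p (assign_subst xs ts)"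

text \<open>The domain of an interpretation is the (nonempty) type \<open>'d\<close>.\<close>

record ('f, 'r, 'd) interp =
  fun_of :: "'f \<Rightarrow> 'd list \<Rightarrow> 'd"
  rel_of :: "'r \<Rightarrow> 'd list \<Rightarrow> bool"

primrec teval :: "('f, 'r, 'd) interp \<Rightarrow> (var \<Rightarrow> 'd) \<Rightarrow> 'f tm \<Rightarrow> 'd" where
  "teval I e (Var x) = e x"
| "teval I e (Fun f ts) = fun_of I f (map (teval I e) ts)"

primrec holds :: "('f, 'r, 'd) interp \<Rightarrow> (var \<Rightarrow> 'd) \<Rightarrow> ('f, 'r) fm \<Rightarrow> bool" where
  "holds I e (Eq s t) \<longleftrightarrow> teval I e s = teval I e t"
| "holds I e (Rel r ts) \<longleftrightarrow> rel_of I r (map (teval I e) ts)"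
| "holds I e (Neg p) \<longleftrightarrow> \<not> holds I e p"
| "holds I e (And p q) \<longleftrightarrow> holds I e p \<and> holds I e q"
| "holds I e (Or p q) \<longleftrightarrow> holds I e p \<or> holds I e q"
| "holds I e (Imp p q) \<longleftrightarrow> (holds I e p \<longrightarrow> holds I e q)"
| "holds I e (Ex x p) \<longleftrightarrow> (\<exists>d. holds I (e(x := d)) p)"
| "holds I e (All x p) \<longleftrightarrow> (\<forall>d. holds I (e(x := d)) p)"

definition true_in :: "('f, 'r, 'd) interp \<Rightarrow> ('f, 'r) fm \<Rightarrow> bool" where
  "true_in I p \<longleftrightarrow> (\<forall>e. holds I e p)"

section \<open>Programs\<close>

datatype ('p, 'f, 'r) stmt =
    Skip
  | Assign "var list" "'f tm list"
  | Call 'p "'f tm list"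
  | Seq "('p, 'f, 'r) stmt" "('p, 'f, 'r) stmt"
  | Cond "('f, 'r) fm" "('p, 'f, 'r) stmt" "('p, 'f, 'r) stmt"
  | While "('f, 'r) fm" "('p, 'f, 'r) stmt"
  | Block "var list" "'f tm list" "('p, 'f, 'r) stmt"

text \<open>The declaration \<open>P(us) :: S\<close> is the triple \<open>(P, us, S)\<close>.\<close>

type_synonym ('p, 'f, 'r) decl = "'p \<times> var list \<times> ('p, 'f, 'r) stmt"

primrec stmt_calls :: "('p, 'f, 'r) stmt \<Rightarrow> ('p \<times> 'f tm list) set" where
  "stmt_calls Skip = {}"
| "stmt_calls (Assign xs ts) = {}"
| "stmt_calls (Call P ts) = {(P, ts)}"
| "stmt_calls (Seq S1 S2) = stmt_calls S1 \<union> stmt_calls S2"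
| "stmt_calls (Cond b S1 S2) = stmt_calls S1 \<union> stmt_calls S2"
| "stmt_calls (While b S) = stmt_calls S"
| "stmt_calls (Block xs ts S) = stmt_calls S"

definition calls :: "('p, 'f, 'r) decl set \<Rightarrow> ('p, 'f, 'r) stmt \<Rightarrow> ('p \<times> 'f tm list) set" where
  "calls D S = stmt_calls S \<union> (\<Union>(P, us, B) \<in> D. stmt_calls B)"

primrec stmt_vars :: "('p, 'f, 'r) stmt \<Rightarrow> var set" where
  "stmt_vars Skip = {}"
| "stmt_vars (Assign xs ts) = set xs \<union> \<Union> (tvars ` set ts)"
| "stmt_vars (Call P ts) = \<Union> (tvars ` set ts)"
| "stmt_vars (Seq S1 S2) = stmt_vars S1 \<union> stmt_vars S2"
| "stmt_vars (Cond b S1 S2) = free b \<union> stmt_vars S1 \<union> stmt_vars S2"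
| "stmt_vars (While b S) = free b \<union> stmt_vars S"
| "stmt_vars (Block xs ts S) = set xs \<union> \<Union> (tvars ` set ts) \<union> stmt_vars S"

definition vars :: "('p, 'f, 'r) decl set \<Rightarrow> ('p, 'f, 'r) stmt \<Rightarrow> var set" where
  "vars D S = stmt_vars S \<union> (\<Union>(P, us, B) \<in> D. set us \<union> stmt_vars B)"

text \<open>\<open>change(D | S)\<close> and \<open>change(D)\<close> are mutually dependent, but \<open>change(D)\<close> uses the former only
  for the empty set of declarations. We therefore abstract the contribution of the calls
  as a function \<open>C\<close> first; the defining equations are the lemmas below.\<close>

primrec change_with :: "('p \<Rightarrow> var set) \<Rightarrow> ('p, 'f, 'r) stmt \<Rightarrow> var set" where
  "change_with C Skip = {}"
| "change_with C (Assign xs ts) = set xs"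
| "change_with C (Call P ts) = C P"
| "change_with C (Seq S1 S2) = change_with C S1 \<union> change_with C S2"
| "change_with C (Cond b S1 S2) = change_with C S1 \<union> change_with C S2"
| "change_with C (While b S) = change_with C S"
| "change_with C (Block xs ts S) = change_with C S - set xs"

definition change_decls :: "('p, 'f, 'r) decl set \<Rightarrow> var set" where
  "change_decls D = (\<Union>(P, us, B) \<in> D. change_with (\<lambda>_. {}) B)"

definition change :: "('p, 'f, 'r) decl set \<Rightarrow> ('p, 'f, 'r) stmt \<Rightarrow> var set" where
  "change D = change_with (\<lambda>P. \<Union>(Q, us, B) \<in> {d \<in> D. fst d = P}. change_decls D - set us)"

lemma change_decls_eq: "change_decls D = (\<Union>(P, us, B) \<in> D. change {} B)"
  by (simp add: change_decls_def change_def)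

lemma change_Call_undeclared: "P \<notin> fst ` D \<Longrightarrow> change D (Call P ts) = {}"
  by (force simp: change_def)

lemma change_Call_declared:
  assumes "\<exists>!d. d \<in> D \<and> fst d = P" and "(P, us, B) \<in> D"
  shows "change D (Call P ts) = change_decls D - set us"
proof -
  have "{d \<in> D. fst d = P} = {(P, us, B)}"
    using assms by auto
  then show ?thesis
    by (simp add: change_def)
qed

primrec wf_stmt :: "('f, 'r) lang \<Rightarrow> ('p, 'f, 'r) decl set \<Rightarrow> ('p, 'f, 'r) stmt \<Rightarrow> bool" where
  "wf_stmt L D Skip = True"
| "wf_stmt L D (Assign xs ts) =
     (distinct xs \<and> length ts = length xs \<and> list_all (is_expr L) ts)"
| "wf_stmt L D (Call P ts) =
     ((\<forall>us B. (P, us, B) \<in> D \<longrightarrow> length ts = length us) \<and> list_all (is_expr L) ts)"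
| "wf_stmt L D (Seq S1 S2) = (wf_stmt L D S1 \<and> wf_stmt L D S2)"
| "wf_stmt L D (Cond b S1 S2) = (is_bexpr L b \<and> wf_stmt L D S1 \<and> wf_stmt L D S2)"
| "wf_stmt L D (While b S) = (is_bexpr L b \<and> wf_stmt L D S)"
| "wf_stmt L D (Block xs ts S) =
     (distinct xs \<and> length ts = length xs \<and> list_all (is_expr L) ts \<and> wf_stmt L D S)"

definition is_program :: "('f, 'r) lang \<Rightarrow> ('p, 'f, 'r) decl set \<Rightarrow> ('p, 'f, 'r) stmt \<Rightarrow> bool" where
  "is_program L D S \<longleftrightarrow>
     finite D \<and>
     (\<forall>P \<in> fst ` D \<union> fst ` calls D S. \<exists>!d. d \<in> D \<and> fst d = P) \<and>
     (\<forall>(P, us, B) \<in> D. distinct us \<and> wf_stmt L D B) \<and>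
     wf_stmt L D S"

section \<open>The proof system\<close>

type_synonym ('p, 'f, 'r) triple = "('f, 'r) fm \<times> ('p, 'f, 'r) stmt \<times> ('f, 'r) fm"

text \<open>\<open>derivable L I D True \<Phi> p S q\<close> is derivability of \<open>{p} S {q}\<close> from \<open>\<Phi>\<close> in ABO1.
  With the flag \<open>False\<close> the rule RECURSION II is excluded: this is the provability
  relation in the premises of that rule, which ``uses the remaining axioms and rules''.
  Conditions \<open>is_assn\<close> are attached only where a rule introduces an assertion that does not
  stem from its premises.\<close>

inductive derivable ::
  "('f, 'r) lang \<Rightarrow> ('f, 'r, 'd) interp \<Rightarrow> ('p, 'f, 'r) decl set \<Rightarrow> bool \<Rightarrow> ('p, 'f, 'r) triple set \<Rightarrow>
   ('f, 'r) fm \<Rightarrow> ('p, 'f, 'r) stmt \<Rightarrow> ('f, 'r) fm \<Rightarrow> bool"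
  for L :: "('f, 'r) lang" and I :: "('f, 'r, 'd) interp" and D :: "('p, 'f, 'r) decl set"
where
  Assumption:
    "(p, S, q) \<in> \<Phi> \<Longrightarrow> derivable L I D rc \<Phi> p S q"
| Skip:
    "is_assn L p \<Longrightarrow> derivable L I D rc \<Phi> p Skip p"
| Parallel_Assignment:
    "is_assn L p \<Longrightarrow> wf_stmt L D (Assign xs ts) \<Longrightarrow>
     derivable L I D rc \<Phi> (p[xs :=\<^sub>s ts]) (Assign xs ts) p"
| Composition:
    "derivable L I D rc \<Phi> p S1 r \<Longrightarrow> derivable L I D rc \<Phi> r S2 q \<Longrightarrow>
     derivable L I D rc \<Phi> p (Seq S1 S2) q"
| Conditional:
    "derivable L I D rc \<Phi> (And p b) S1 q \<Longrightarrow> derivable L I D rc \<Phi> (And p (Neg b)) S2 q \<Longrightarrow>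
     derivable L I D rc \<Phi> p (Cond b S1 S2) q"
| Loop:
    "derivable L I D rc \<Phi> (And p b) S p \<Longrightarrow>
     derivable L I D rc \<Phi> p (While b S) (And p (Neg b))"
| Block:
    "derivable L I D rc \<Phi> p (Seq (Assign xs ts) S) q \<Longrightarrow> set xs \<inter> free q = {} \<Longrightarrow>
     derivable L I D rc \<Phi> p (Block xs ts S) q"
| Substitution:
    "derivable L I D rc \<Phi> p S q \<Longrightarrow>
     distinct xs \<Longrightarrow> length ys = length xs \<Longrightarrow>
     set xs \<inter> vars D S = {} \<Longrightarrow> set ys \<inter> change D S = {} \<Longrightarrow>
     derivable L I D rc \<Phi> (p[xs :=\<^sub>s map Var ys]) S (q[xs :=\<^sub>s map Var ys])"
| Invariance:
    "derivable L I D rc \<Phi> r S q \<Longrightarrow> is_assn L p \<Longrightarrow> free p \<inter> change D S = {} \<Longrightarrow>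
     derivable L I D rc \<Phi> (And p r) S (And p q)"
| Ex_Introduction:
    "derivable L I D rc \<Phi> p S q \<Longrightarrow> set xs \<inter> (vars D S \<union> free q) = {} \<Longrightarrow>
     derivable L I D rc \<Phi> (foldr Ex xs p) S q"
| Consequence:
    "is_assn L p \<Longrightarrow> is_assn L q \<Longrightarrow>
     true_in I (Imp p p1) \<Longrightarrow> derivable L I D rc \<Phi> p1 S q1 \<Longrightarrow> true_in I (Imp q1 q) \<Longrightarrow>
     derivable L I D rc \<Phi> p S q"
| Procedure_Call:
    "derivable L I D rc \<Phi> p (Call P (map Var us)) q \<Longrightarrow>
     (P, us, B) \<in> D \<Longrightarrow> set us \<inter> free q = {} \<Longrightarrow> wf_stmt L D (Call P ts) \<Longrightarrow>
     derivable L I D rc \<Phi> (p[us :=\<^sub>s ts]) (Call P ts) q"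
| Recursion_II:
    "calls D S = {(P i, t i) |i. i \<in> {1..k}} \<Longrightarrow>
     \<forall>i \<in> {1..k}. (P i, u i, B i) \<in> D \<and> is_assn L (ps i) \<and> is_assn L (qs i) \<Longrightarrow>
     \<Psi> = {(ps i, Call (P i) (t i), qs i) |i. i \<in> {1..k}} \<Longrightarrow>
     derivable L I D False \<Psi> p S q \<Longrightarrow>
     \<forall>i \<in> {1..k::nat}. derivable L I D False \<Psi> (ps i) (Block (u i) (t i) (B i)) (qs i) \<Longrightarrow>
     derivable L I D True \<Phi> p S q"

abbreviation ABO1 ::
  "('f, 'r) lang \<Rightarrow> ('f, 'r, 'd) interp \<Rightarrow> ('p, 'f, 'r) decl set \<Rightarrow> ('p, 'f, 'r) triple set \<Rightarrow>
   ('f, 'r) fm \<Rightarrow> ('p, 'f, 'r) stmt \<Rightarrow> ('f, 'r) fm \<Rightarrow> bool" where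
  "ABO1 L I D \<equiv> derivable L I D True"

end

theory Submission
  imports Defs
begin

text \<open>The assumptions \<open>\<Phi>\<close> concern generic calls, whereas RECURSION II needs assumptions on exactly
  the calls \<open>P(ts)\<close> that occur in the program. Together with the assumptions of the uses of
  RECURSION II inside the given derivations, \<open>\<Phi>\<close> forms a finite set \<open>\<Gamma>\<close> each of whose triples is
  provable from \<open>\<Gamma>\<close> for the corresponding block. Every triple \<open>{a} P(us) {b}\<close> of \<open>\<Gamma>\<close> is replaced by
  the triples \<open>{a\<sigma> \<and> \<sigma>(us) = ts} P(ts) {b\<sigma>}\<close>, where \<open>\<sigma>\<close> renames the formal parameters and the
  logical variables of the triple to fresh variables. The adaptation rules (SUBSTITUTION, INVARIANCE,
  EXISTS-INTRODUCTION, CONSEQUENCE) applied to a generic call can then be repeated for \<open>P(ts)\<close>, for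
  every renaming \<open>\<sigma>\<close> that respects the program variables, and quantifying away \<open>\<sigma>(us)\<close> simulates
  PROCEDURE CALL. The same argument for blocks justifies the new triples.\<close>

section \<open>Substitution and renaming\<close>

lemma finite_tvars [simp]: "finite (tvars t)"
  by (induction t) auto

lemma finite_free [simp]: "finite (free p)"
  by (induction p) auto

lemma variant_notin: "finite V \<Longrightarrow> variant x V \<notin> V"
  unfolding variant_def using LeastI_ex[of "\<lambda>z. z \<notin> V"] ex_new_if_finite[of V] by auto

lemma teval_cong: "(\<And>x. x \<in> tvars t \<Longrightarrow> e x = e' x) \<Longrightarrow> teval I e t = teval I e' t"
proof (induction t)
  case (Fun f ts)
  then have "map (teval I e) ts = map (teval I e') ts" by (auto intro!: map_cong)
  then show ?case by (metis teval.simps(2))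
qed simp

lemma holds_cong: "(\<And>x. x \<in> free p \<Longrightarrow> e x = e' x) \<Longrightarrow> holds I e p = holds I e' p"
proof (induction p arbitrary: e e')
  case (Eq s t)
  then show ?case using teval_cong[of s e e' I] teval_cong[of t e e' I] by auto
next
  case (Rel r ts)
  then have "map (teval I e) ts = map (teval I e') ts" by (auto intro!: map_cong teval_cong)
  then show ?case by (metis holds.simps(2))
next
  case (Ex x p)
  have "holds I (e(x := d)) p = holds I (e'(x := d)) p" for d
    by (rule Ex.IH) (use Ex.prems in auto)
  then show ?case by simp
next
  case (All x p)
  have "holds I (e(x := d)) p = holds I (e'(x := d)) p" for d
    by (rule All.IH) (use All.prems in auto)
  then show ?case by simp
next
  case (Neg p)
  have "holds I e p = holds I e' p" by (rule Neg.IH) (use Neg.prems in simp)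
  then show ?case by simp
next
  case (And p q)
  have "holds I e p = holds I e' p" "holds I e q = holds I e' q"
    by (rule And.IH; use And.prems in simp)+
  then show ?case by simp
next
  case (Or p q)
  have "holds I e p = holds I e' p" "holds I e q = holds I e' q"
    by (rule Or.IH; use Or.prems in simp)+
  then show ?case by simp
next
  case (Imp p q)
  have "holds I e p = holds I e' p" "holds I e q = holds I e' q"
    by (rule Imp.IH; use Imp.prems in simp)+
  then show ?case by simp
qed

lemma teval_tsubst: "teval I e (tsubst t \<sigma>) = teval I (\<lambda>x. teval I e (\<sigma> x)) t"
proof (induction t)
  case (Fun f ts)
  then have "map (teval I e) (map (\<lambda>t. tsubst t \<sigma>) ts) = map (teval I (\<lambda>x. teval I e (\<sigma> x))) ts"
    by auto
  then show ?case by (metis teval.simps(2) tsubst.simps(2))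
qed simp

text \<open>The bound variable \<open>z\<close> avoids the terms put for the other free variables,
  so updating \<open>z\<close> leaves their values alone. With the induction hypothesis as a
  premise, the argument serves both quantifiers.\<close>

lemma holds_subst_bound:
  fixes \<sigma> :: "var \<Rightarrow> 'f tm" and p :: "('f, 'r) fm"
  assumes IH: "\<And>\<sigma> e. holds I e (subst p \<sigma>) = holds I (\<lambda>x. teval I e (\<sigma> x)) p"
    and z: "z = variant x (\<Union>y \<in> free p - {x}. tvars (\<sigma> y))"
  shows "holds I (e(z := d)) (subst p (\<sigma>(x := Var z))) = holds I ((\<lambda>x. teval I e (\<sigma> x))(x := d)) p"
proof -
  have fresh: "z \<notin> (\<Union>y \<in> free p - {x}. tvars (\<sigma> y))"
    unfolding z by (rule variant_notin) simp
  show ?thesis unfolding IH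
  proof (rule holds_cong)
    fix y assume y: "y \<in> free p"
    show "teval I (e(z := d)) ((\<sigma>(x := Var z)) y) = ((\<lambda>x. teval I e (\<sigma> x))(x := d)) y"
    proof (cases "y = x")
      case False
      with y fresh have "z \<notin> tvars (\<sigma> y)" by blast
      then have "teval I (e(z := d)) (\<sigma> y) = teval I e (\<sigma> y)" by (intro teval_cong) auto
      with False show ?thesis by simp
    qed simp
  qed
qed

lemma holds_subst: "holds I e (subst p \<sigma>) = holds I (\<lambda>x. teval I e (\<sigma> x)) p"
proof (induction p arbitrary: \<sigma> e)
  case (Eq s t)
  show ?case by (simp add: teval_tsubst)
next
  case (Rel r ts)
  show ?case by (simp add: teval_tsubst comp_def)
next
  case (Ex x p)
  show ?case by (simp add: Let_def holds_subst_bound[OF Ex.IH refl])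
next
  case (All x p)
  show ?case by (simp add: Let_def holds_subst_bound[OF All.IH refl])
qed simp_all

lemma tvars_tsubst: "tvars (tsubst t \<sigma>) = (\<Union>y \<in> tvars t. tvars (\<sigma> y))"
  by (induction t) auto

lemma free_subst_bound:
  fixes \<sigma> :: "var \<Rightarrow> 'f tm" and p :: "('f, 'r) fm"
  assumes "z = variant x (\<Union>y \<in> free p - {x}. tvars (\<sigma> y))"
  shows "(\<Union>y \<in> free p. tvars ((\<sigma>(x := Var z)) y)) - {z} = (\<Union>y \<in> free p - {x}. tvars (\<sigma> y))"
proof -
  have "z \<notin> (\<Union>y \<in> free p - {x}. tvars (\<sigma> y))"
    unfolding assms by (rule variant_notin) simp
  then show ?thesis by (auto split: if_splits)
qed

lemma free_subst: "free (subst p \<sigma>) = (\<Union>y \<in> free p. tvars (\<sigma> y))"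
proof (induction p arbitrary: \<sigma>)
  case (Ex x p)
  show ?case by (simp only: subst.simps Let_def free.simps Ex.IH free_subst_bound[OF refl])
next
  case (All x p)
  show ?case by (simp only: subst.simps Let_def free.simps All.IH free_subst_bound[OF refl])
qed (auto simp: tvars_tsubst)

lemma is_expr_tsubst: "is_expr L t \<Longrightarrow> (\<And>x. is_expr L (\<sigma> x)) \<Longrightarrow> is_expr L (tsubst t \<sigma>)"
  by (induction t) (auto simp: list_all_iff)

lemma is_assn_subst: "is_assn L p \<Longrightarrow> (\<And>x. is_expr L (\<sigma> x)) \<Longrightarrow> is_assn L (subst p \<sigma>)"
  by (induction p arbitrary: \<sigma>) (auto simp: list_all_iff is_expr_tsubst Let_def)

lemma is_expr_assign_subst: "list_all (is_expr L) ts \<Longrightarrow> is_expr L (assign_subst xs ts x)"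
  by (auto simp: assign_subst_def list_all_iff split: option.split dest!: map_of_SomeD set_zip_rightD)

lemma assign_subst_outside: "x \<notin> set xs \<Longrightarrow> assign_subst xs ts x = Var x"
  by (auto simp: assign_subst_def split: option.split dest!: map_of_SomeD set_zip_leftD)

lemma assign_subst_map: "assign_subst xs (map f xs) = (\<lambda>x. if x \<in> set xs then f x else Var x)"
  by (auto simp: assign_subst_def map_of_zip_map)

lemma assign_subst_Var [simp]: "assign_subst xs (map Var xs) = Var"
  by (auto simp: assign_subst_map)

lemma assign_subst_nth:
  assumes "length ts = length xs" and "x \<in> set xs"
  obtains i where "i < length xs" and "xs ! i = x" and "assign_subst xs ts x = ts ! i"
proof -
  obtain t where t: "map_of (zip xs ts) x = Some t"
    using assms map_of_zip_is_Some[of xs ts x] by auto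
  then have "(x, t) \<in> set (zip xs ts)" by (rule map_of_SomeD)
  with assms t that show ?thesis by (auto simp: in_set_zip assign_subst_def)
qed

lemma assign_subst_distinct:
  assumes "distinct xs" and "length ts = length xs" and "i < length xs"
  shows "assign_subst xs ts (xs ! i) = ts ! i"
  using assms by (simp add: assign_subst_def map_of_zip_nth)

abbreviation rename :: "(var \<Rightarrow> var) \<Rightarrow> ('f, 'r) fm \<Rightarrow> ('f, 'r) fm" where
  "rename \<sigma> p \<equiv> subst p (\<lambda>x. Var (\<sigma> x))"

lemma holds_rename: "holds I e (rename \<sigma> p) = holds I (\<lambda>x. e (\<sigma> x)) p"
  by (simp add: holds_subst)

lemma free_rename: "free (rename \<sigma> p) = \<sigma> ` free p"
  by (auto simp: free_subst)

lemma is_assn_rename: "is_assn L p \<Longrightarrow> is_assn L (rename \<sigma> p)"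
  by (simp add: is_assn_subst)

lemma holds_foldr_Ex:
  "holds I e (foldr Ex xs p) \<longleftrightarrow> (\<exists>e'. (\<forall>y. y \<notin> set xs \<longrightarrow> e' y = e y) \<and> holds I e' p)"
proof (induction xs arbitrary: e)
  case Nil
  have "e' = e" if "\<forall>y. e' y = e y" for e' using that by auto
  then show ?case by auto
next
  case (Cons x xs)
  show ?case (is "?l \<longleftrightarrow> ?r")
  proof
    assume ?l
    then obtain d e' where "\<forall>y. y \<notin> set xs \<longrightarrow> e' y = (e(x := d)) y" "holds I e' p"
      using Cons.IH by auto
    then show ?r by (intro exI[of _ e']) auto
  next
    assume ?r
    then obtain e' where "\<forall>y. y \<notin> set (x # xs) \<longrightarrow> e' y = e y" "holds I e' p" by auto
    then have "holds I (e(x := e' x)) (foldr Ex xs p)"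
      unfolding Cons.IH by (intro exI[of _ e']) auto
    then show ?l by auto
  qed
qed

lemma is_assn_foldr_Ex [simp]: "is_assn L (foldr Ex xs p) = is_assn L p"
  by (induction xs) auto

text \<open>The formulas have no constant for truth, so \<open>Eq (Var 0) (Var 0)\<close> is the
  empty conjunction. The free variable 0 that it adds is harmless: \<open>equate\<close> occurs only
  in preconditions, whose free variables EXISTS-INTRODUCTION does not restrict.\<close>

definition equate :: "var list \<Rightarrow> 'f tm list \<Rightarrow> ('f, 'r) fm" where
  "equate xs ts = foldr And (map2 (\<lambda>x t. Eq (Var x) t) xs ts) (Eq (Var 0) (Var 0))"

lemma holds_equate:
  "length ts = length xs \<Longrightarrow> holds I e (equate xs ts) \<longleftrightarrow> map e xs = map (teval I e) ts"
  by (induction ts xs rule: list_induct2) (auto simp: equate_def)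

lemma is_assn_equate:
  "length ts = length xs \<Longrightarrow> list_all (is_expr L) ts \<Longrightarrow> is_assn L (equate xs ts)"
  by (induction ts xs rule: list_induct2) (auto simp: equate_def)

lemma teval_assign_subst_equate:
  assumes "length ts = length us" and "map e (map \<sigma> us) = map (teval I e) ts" and "x \<in> set us"
  shows "teval I e (assign_subst us ts x) = e (\<sigma> x)"
proof -
  obtain i where i: "i < length us" "us ! i = x" "assign_subst us ts x = ts ! i"
    using assign_subst_nth assms(1,3) by blast
  have "map e (map \<sigma> us) ! i = map (teval I e) ts ! i" by (simp only: assms(2))
  with i assms(1) show ?thesis by simp
qed

section \<open>Variables of programs\<close>

lemma finite_stmt_vars [simp]: "finite (stmt_vars S)"
  by (induction S) auto

lemma finite_vars: "finite D \<Longrightarrow> finite (vars D S)"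
  by (auto simp: vars_def)

text \<open>\<open>vars D Skip\<close> stands throughout for the variables of the declarations
  alone, because \<open>Skip\<close> contributes none.\<close>

lemma vars_Skip: "vars D S = stmt_vars S \<union> vars D Skip"
  by (auto simp: vars_def)

lemma change_with_subset: "(\<And>P. C P \<subseteq> V) \<Longrightarrow> change_with C S \<subseteq> stmt_vars S \<union> V"
  by (induction S) auto

lemma change_decls_subset: "change_decls D \<subseteq> vars D Skip"
  using change_with_subset[of "\<lambda>_. {}" "{}"] by (fastforce simp: change_decls_def vars_def)

lemma change_subset: "change D S \<subseteq> stmt_vars S \<union> vars D Skip"
  unfolding change_def using change_decls_subset[of D] by (intro change_with_subset) auto

lemma wf_stmt_calls: "wf_stmt L D S \<Longrightarrow> (P, ts) \<in> stmt_calls S \<Longrightarrow> wf_stmt L D (Call P ts)"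
  by (induction S) auto

section \<open>Derivability\<close>

lemma derivable_mono: "derivable L I D rc \<Gamma> p S q \<Longrightarrow> \<Gamma> \<subseteq> \<Gamma>' \<Longrightarrow> derivable L I D rc \<Gamma>' p S q"
proof (induction rule: derivable.induct)
  case (Recursion_II S P t k u B ps qs \<Psi> p q \<Phi>)
  show ?case
    by (rule derivable.Recursion_II[OF Recursion_II.hyps(1-3)]) (use Recursion_II in auto)
qed (auto intro: derivable.intros)

text \<open>Admitting only calls makes the case of an assumption vacuous in inductions about
  assignments, compositions and blocks.\<close>

definition assn_triples :: "('f, 'r) lang \<Rightarrow> ('p, 'f, 'r) triple set \<Rightarrow> bool" where
  "assn_triples L \<Gamma> \<longleftrightarrow> (\<forall>(a, C, b) \<in> \<Gamma>. is_assn L a \<and> is_assn L b \<and> (\<exists>P ts. C = Call P ts))"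

lemma assn_triplesD:
  "assn_triples L \<Gamma> \<Longrightarrow> (a, C, b) \<in> \<Gamma> \<Longrightarrow> is_assn L a \<and> is_assn L b \<and> (\<exists>P ts. C = Call P ts)"
  by (auto simp: assn_triples_def)

lemma derivable_is_assn:
  "derivable L I D rc \<Gamma> p S q \<Longrightarrow> assn_triples L \<Gamma> \<Longrightarrow> is_assn L p \<and> is_assn L q"
proof (induction rule: derivable.induct)
  case (Recursion_II S P t k u B ps qs \<Psi> p q \<Phi>)
  then have "assn_triples L \<Psi>" by (auto simp: assn_triples_def)
  with Recursion_II show ?case by blast
qed (auto simp: is_assn_subst is_expr_assign_subst list_all_iff dest: assn_triplesD)

lemma derivable_consequence:
  assumes "derivable L I D rc \<Gamma> p S q" and "is_assn L p'" and "is_assn L q'"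
    and "\<And>e. holds I e p' \<Longrightarrow> holds I e p" and "\<And>e. holds I e q \<Longrightarrow> holds I e q'"
  shows "derivable L I D rc \<Gamma> p' S q'"
  by (rule derivable.Consequence[of _ _ _ _ p _ _ _ _ q]) (use assms in \<open>auto simp: true_in_def\<close>)

text \<open>SUBSTITUTION for a map that moves only a finite set \<open>X\<close>; the distinct list
  which the rule demands enumerates \<open>X\<close>. The images may be program variables as long as
  they are not changed.\<close>

lemma derivable_rename:
  fixes p q :: "('f, 'r) fm"
  assumes "derivable L I D rc \<Gamma> p S q" and "finite X" and "\<And>x. x \<notin> X \<Longrightarrow> \<tau> x = x"
    and "X \<inter> vars D S = {}" and "\<tau> ` X \<inter> change D S = {}"
  shows "derivable L I D rc \<Gamma> (rename \<tau> p) S (rename \<tau> q)"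
proof -
  let ?xs = "sorted_list_of_set X"
  have "assign_subst ?xs (map Var (map \<tau> ?xs)) = (\<lambda>x. Var (\<tau> x) :: 'f tm)"
    using assms(2,3) by (auto simp: assign_subst_map comp_def)
  then show ?thesis
    using derivable.Substitution[OF assms(1), of ?xs "map \<tau> ?xs"] assms by simp
qed

lemma assign_subst_renaming:
  assumes "length ys = length xs"
  obtains \<tau> where "assign_subst xs (map Var ys) = (\<lambda>x. Var (\<tau> x) :: 'f tm)"
    and "\<And>x. x \<notin> set xs \<Longrightarrow> \<tau> x = x" and "\<And>x. x \<in> set xs \<Longrightarrow> \<tau> x \<in> set ys"
proof -
  have "\<exists>y. assign_subst xs (map Var ys) x = (Var y :: 'f tm) \<and> (if x \<in> set xs then y \<in> set ys else y = x)" for x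
  proof (cases "x \<in> set xs")
    case True
    then obtain i where "i < length xs" "assign_subst xs (map Var ys) x = (map Var ys ! i :: 'f tm)"
      using assign_subst_nth[of "map Var ys" xs x] assms by auto
    with True assms show ?thesis by (intro exI[of _ "ys ! i"]) auto
  next
    case False
    then show ?thesis by (simp add: assign_subst_outside)
  qed
  then obtain \<tau> where \<tau>: "\<And>x. assign_subst xs (map Var ys) x = (Var (\<tau> x) :: 'f tm) \<and>
      (if x \<in> set xs then \<tau> x \<in> set ys else \<tau> x = x)"
    by metis
  show ?thesis
  proof (rule that[of \<tau>])
    show "assign_subst xs (map Var ys) = (\<lambda>x. Var (\<tau> x) :: 'f tm)" using \<tau> by blast
    show "x \<notin> set xs \<Longrightarrow> \<tau> x = x" "x \<in> set xs \<Longrightarrow> \<tau> x \<in> set ys" for x using \<tau>[of x] by auto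
  qed
qed

section \<open>Removing the assignment of variables to themselves\<close>

text \<open>Assumptions concern calls and RECURSION II is excluded, so only PARALLEL ASSIGNMENT and
  the adaptation rules can end a derivation about \<open>us := us\<close>. As this assignment leaves
  the state alone, each of them preserves the implication in every environment.\<close>

lemma identity_assignment_sound:
  "derivable L I D rc \<Gamma> p S q \<Longrightarrow> \<not> rc \<Longrightarrow> S = Assign us (map Var us) \<Longrightarrow> assn_triples L \<Gamma> \<Longrightarrow>
   holds I e p \<Longrightarrow> holds I e q"
proof (induction arbitrary: e rule: derivable.induct)
  case (Substitution rc \<Phi> p S q xs ys)
  then show ?case by (simp add: holds_subst)
next
  case (Ex_Introduction rc \<Phi> p S q xs)
  from Ex_Introduction.prems obtain e' where "\<forall>y. y \<notin> set xs \<longrightarrow> e' y = e y" "holds I e' p"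
    by (auto simp: holds_foldr_Ex)
  moreover from this have "holds I e' q" using Ex_Introduction by blast
  moreover have "holds I e' q = holds I e q"
    by (rule holds_cong) (use \<open>\<forall>y. y \<notin> set xs \<longrightarrow> e' y = e y\<close> Ex_Introduction.hyps in auto)
  ultimately show ?case by blast
next
  case (Parallel_Assignment p xs ts rc \<Phi>)
  then show ?case by (simp add: holds_subst)
qed (auto simp: true_in_def dest: assn_triplesD)

text \<open>At COMPOSITION the precondition implies the intermediate assertion, so CONSEQUENCE
  absorbs the assignment. The adaptation rules can be repeated for \<open>B\<close> alone, which has
  no more variables or changed variables than the composition.\<close>

lemma identity_assignment_elim:
  "derivable L I D rc \<Gamma> p S q \<Longrightarrow> \<not> rc \<Longrightarrow> S = Seq (Assign us (map Var us)) B \<Longrightarrow> assn_triples L \<Gamma> \<Longrightarrow>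
   derivable L I D rc \<Gamma> p B q"
proof (induction rule: derivable.induct)
  case (Composition rc \<Phi> p S1 r S2 q)
  then have "derivable L I D rc \<Phi> r B q" by simp
  moreover have "is_assn L p" "is_assn L q"
    using Composition derivable_is_assn by blast+
  moreover have "holds I e p \<Longrightarrow> holds I e r" for e
    by (rule identity_assignment_sound[OF Composition.hyps(1)]) (use Composition in auto)
  ultimately show ?case by (rule derivable_consequence)
next
  case (Substitution rc \<Phi> p S q xs ys)
  then show ?case by (intro derivable.Substitution) (auto simp: vars_def change_def)
next
  case (Invariance rc \<Phi> r S q p)
  then show ?case by (intro derivable.Invariance) (auto simp: change_def)
next
  case (Ex_Introduction rc \<Phi> p S q xs)
  then show ?case by (intro derivable.Ex_Introduction) (auto simp: vars_def)
next
  case (Consequence p q p1 rc \<Phi> S q1)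
  then show ?case by (auto intro: derivable.Consequence)
qed (auto dest: assn_triplesD)

section \<open>From generic calls to arbitrary calls\<close>

text \<open>For the generic triple, everything outside \<open>vars D Skip\<close>, and also the
  formal parameters, acts as a logical variable. Such a variable may go to any variable that
  \<open>T\<close> does not change, even one occurring in the actual parameters; this liberty keeps
  the notion closed under composition with the maps used by SUBSTITUTION.\<close>

definition admissible :: "('p, 'f, 'r) decl set \<Rightarrow> ('p, 'f, 'r) stmt \<Rightarrow> var list \<Rightarrow> (var \<Rightarrow> var) \<Rightarrow> bool" where
  "admissible D T us \<sigma> \<longleftrightarrow> (\<forall>x. if x \<in> vars D Skip - set us then \<sigma> x = x else \<sigma> x \<notin> change D T)"

text \<open>The substitution-closed form of ``the triple \<open>{p} P(us) {q}\<close> transferred to \<open>P(ts)\<close>''. The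
  formal parameters, which a call does not change, become logical variables holding the initial
  values of \<open>ts\<close>; the other logical variables are renamed since they may occur in \<open>ts\<close>.\<close>

definition adapts where
  "adapts L I D \<Psi> us ts T p q \<longleftrightarrow> (\<forall>\<sigma>. admissible D T us \<sigma> \<longrightarrow>
     derivable L I D False \<Psi> (And (rename \<sigma> p) (equate (map \<sigma> us) ts)) T (rename \<sigma> q))"

lemma adaptsD:
  "adapts L I D \<Psi> us ts T p q \<Longrightarrow> admissible D T us \<sigma> \<Longrightarrow>
   derivable L I D False \<Psi> (And (rename \<sigma> p) (equate (map \<sigma> us) ts)) T (rename \<sigma> q)"
  by (simp add: adapts_def)

text \<open>When all variables in use lie below \<open>N\<close>, the moved ones become fresh, and
  subtracting \<open>N\<close> undoes the move.\<close>

definition fresh_renaming :: "('p, 'f, 'r) decl set \<Rightarrow> nat \<Rightarrow> var list \<Rightarrow> var \<Rightarrow> var" where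
  "fresh_renaming D N us x = (if x \<in> vars D Skip - set us then x else x + N)"

text \<open>It suffices to treat one sufficiently fresh renaming, because SUBSTITUTION yields the others.\<close>

lemma adapts_fresh:
  assumes der: "derivable L I D False \<Psi> (And (rename (fresh_renaming D N us) a)
      (equate (map (fresh_renaming D N us) us) ts)) T (rename (fresh_renaming D N us) b)"
    and N: "free a \<union> free b \<union> vars D T \<union> set us \<union> \<Union> (tvars ` set ts) \<subseteq> {..<N}"
    and len: "length ts = length us" and ex: "list_all (is_expr L) ts"
    and assn: "is_assn L a" "is_assn L b"
  shows "adapts L I D \<Psi> us ts T a b"
  unfolding adapts_def
proof (intro allI impI)
  fix \<sigma> assume adm: "admissible D T us \<sigma>"
  let ?\<rho> = "fresh_renaming D N us"
  \<comment> \<open>\<open>X\<close> holds the shifted copies of the moved variables. Undoing the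
    shift and applying \<open>\<sigma>\<close> gives \<open>\<tau>\<close>, whose composition with
    the fresh renaming is \<open>\<sigma>\<close> below \<open>N\<close>; the cut at
    \<open>N + N\<close> keeps \<open>X\<close> finite.\<close>
  define X where "X = {v. N \<le> v \<and> v < N + N \<and> v - N \<notin> vars D Skip - set us}"
  define \<tau> where "\<tau> v = (if v \<in> X then \<sigma> (v - N) else v)" for v
  have \<tau>\<rho>: "\<tau> (?\<rho> x) = \<sigma> x" if "x < N" for x
    using that adm by (auto simp: \<tau>_def X_def fresh_renaming_def admissible_def split: if_splits)
  have "finite X" by (rule finite_subset[of _ "{..<N + N}"]) (auto simp: X_def)
  moreover have "X \<inter> vars D T = {}" using N by (auto simp: X_def)
  moreover have "\<tau> ` X \<inter> change D T = {}"
    using adm by (auto simp: \<tau>_def X_def admissible_def split: if_splits)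
  ultimately have "derivable L I D False \<Psi>
      (rename \<tau> (And (rename ?\<rho> a) (equate (map ?\<rho> us) ts))) T (rename \<tau> (rename ?\<rho> b))"
    by (intro derivable_rename[OF der]) (auto simp: \<tau>_def)
  then show "derivable L I D False \<Psi> (And (rename \<sigma> a) (equate (map \<sigma> us) ts)) T (rename \<sigma> b)"
  proof (rule derivable_consequence)
    show "is_assn L (And (rename \<sigma> a) (equate (map \<sigma> us) ts))" "is_assn L (rename \<sigma> b)"
      using assn ex len by (auto simp: is_assn_rename is_assn_equate)
  next
    fix e assume h: "holds I e (And (rename \<sigma> a) (equate (map \<sigma> us) ts))"
    have "holds I (\<lambda>x. e (\<tau> (?\<rho> x))) a = holds I (\<lambda>x. e (\<sigma> x)) a"
      by (rule holds_cong) (use N \<tau>\<rho> in auto)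
    moreover have "map (\<lambda>x. e (\<tau> x)) (map ?\<rho> us) = map e (map \<sigma> us)"
      using N \<tau>\<rho> by auto
    moreover have "map (teval I (\<lambda>x. e (\<tau> x))) ts = map (teval I e) ts"
    proof (rule map_cong[OF refl], rule teval_cong)
      fix t x assume "t \<in> set ts" "x \<in> tvars t"
      then have "x < N" using N by auto
      then show "e (\<tau> x) = e x" by (simp add: \<tau>_def X_def)
    qed
    ultimately show "holds I e (rename \<tau> (And (rename ?\<rho> a) (equate (map ?\<rho> us) ts)))"
      using h len by (simp add: holds_subst holds_equate del: map_map map_eq_conv)
  next
    fix e assume "holds I e (rename \<tau> (rename ?\<rho> b))"
    moreover have "holds I (\<lambda>x. e (\<tau> (?\<rho> x))) b = holds I (\<lambda>x. e (\<sigma> x)) b"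
      by (rule holds_cong) (use N \<tau>\<rho> in auto)
    ultimately show "holds I e (rename \<sigma> b)" by (simp add: holds_subst)
  qed
qed

section \<open>Repeating the adaptation rules under every admissible renaming\<close>

text \<open>Renaming by \<open>\<sigma>\<close> after the substitution amounts to the single
  renaming \<open>\<sigma> \<circ> \<tau>\<close>, which is again admissible, so the hypothesis is
  simply instantiated. The assertions are compared by their truth only, hence the final
  CONSEQUENCE.\<close>

lemma adapts_substitution:
  assumes ad: "adapts L I D \<Psi> us ts T p q" and len: "length ys = length xs"
    and xs: "set xs \<inter> vars D Skip = {}" and ys: "set ys \<inter> change D T = {}"
    and us: "set us \<subseteq> vars D Skip" "length ts = length us" "list_all (is_expr L) ts"
    and assn: "is_assn L p" "is_assn L q"
  shows "adapts L I D \<Psi> us ts T (p[xs :=\<^sub>s map Var ys]) (q[xs :=\<^sub>s map Var ys])"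
  unfolding adapts_def
proof (intro allI impI)
  fix \<sigma> assume adm: "admissible D T us \<sigma>"
  obtain \<tau> where \<tau>: "assign_subst xs (map Var ys) = (\<lambda>x. Var (\<tau> x) :: 'a tm)"
    "\<And>x. x \<notin> set xs \<Longrightarrow> \<tau> x = x" "\<And>x. x \<in> set xs \<Longrightarrow> \<tau> x \<in> set ys"
    using assign_subst_renaming[OF len] by blast
  have "admissible D T us (\<sigma> \<circ> \<tau>)" unfolding admissible_def
  proof
    fix x
    have "\<sigma> (\<tau> x) \<notin> change D T" if "x \<in> set xs"
      using \<tau>(3)[OF that] ys adm[unfolded admissible_def, rule_format, of "\<tau> x"]
      by (auto split: if_splits)
    then show "if x \<in> vars D Skip - set us then (\<sigma> \<circ> \<tau>) x = x else (\<sigma> \<circ> \<tau>) x \<notin> change D T"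
      using \<tau>(2)[of x] xs adm[unfolded admissible_def, rule_format, of x]
      by (cases "x \<in> set xs") auto
  qed
  moreover have "map (\<sigma> \<circ> \<tau>) us = map \<sigma> us" using \<tau>(2) us(1) xs by (auto intro!: arg_cong[of _ _ \<sigma>])
  ultimately have "derivable L I D False \<Psi> (And (rename (\<sigma> \<circ> \<tau>) p) (equate (map \<sigma> us) ts)) T
      (rename (\<sigma> \<circ> \<tau>) q)"
    using adaptsD[OF ad] by metis
  then show "derivable L I D False \<Psi>
      (And (rename \<sigma> (p[xs :=\<^sub>s map Var ys])) (equate (map \<sigma> us) ts)) T
      (rename \<sigma> (q[xs :=\<^sub>s map Var ys]))"
    by (rule derivable_consequence)
      (use assn us in \<open>auto simp: \<tau>(1) is_assn_rename is_assn_equate holds_subst\<close>)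
qed

text \<open>A free variable of \<open>p\<close> is either fixed by \<open>\<sigma>\<close> and
  unchanged by hypothesis, or sent to an unchanged variable; so INVARIANCE applies to the renamed
  \<open>p\<close>.\<close>

lemma adapts_invariance:
  assumes ad: "adapts L I D \<Psi> us ts T r q"
    and fr: "free p \<inter> change D T = {}"
    and us: "length ts = length us" "list_all (is_expr L) ts"
    and assn: "is_assn L p" "is_assn L q" "is_assn L r"
  shows "adapts L I D \<Psi> us ts T (And p r) (And p q)"
  unfolding adapts_def
proof (intro allI impI)
  fix \<sigma> assume adm: "admissible D T us \<sigma>"
  have "\<sigma> x \<notin> change D T" if "x \<in> free p" for x
    using that fr adm[unfolded admissible_def, rule_format, of x] by (auto split: if_splits)
  then have "free (rename \<sigma> p) \<inter> change D T = {}" by (auto simp: free_rename)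
  then have "derivable L I D False \<Psi> (And (rename \<sigma> p) (And (rename \<sigma> r) (equate (map \<sigma> us) ts))) T
      (And (rename \<sigma> p) (rename \<sigma> q))"
    using adaptsD[OF ad adm] assn(1) by (intro derivable.Invariance) (auto simp: is_assn_rename)
  then show "derivable L I D False \<Psi> (And (rename \<sigma> (And p r)) (equate (map \<sigma> us) ts)) T
      (rename \<sigma> (And p q))"
    by (rule derivable_consequence) (use assn us in \<open>auto simp: is_assn_rename is_assn_equate\<close>)
qed

text \<open>The variables \<open>xs\<close> may occur in \<open>ts\<close>, which bars quantifying
  them for \<open>T\<close>. As the hypothesis covers every admissible renaming, they can first be
  sent to fresh numbers above \<open>M\<close>, and these copies are quantified.\<close>

lemma adapts_Ex:
  assumes ad: "adapts L I D \<Psi> us ts T p q" and fin: "finite D"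
    and xs: "set xs \<inter> (vars D Skip \<union> free q) = {}"
    and us: "set us \<subseteq> vars D Skip" "length ts = length us" "list_all (is_expr L) ts"
    and assn: "is_assn L p" "is_assn L q"
  shows "adapts L I D \<Psi> us ts T (foldr Ex xs p) q"
  unfolding adapts_def
proof (intro allI impI)
  fix \<sigma> assume adm: "admissible D T us \<sigma>"
  have "finite (vars D T \<union> \<sigma> ` (free p \<union> free q \<union> set us) \<union> \<Union> (tvars ` set ts))"
    using fin by (simp add: finite_vars)
  then obtain M where M: "vars D T \<union> \<sigma> ` (free p \<union> free q \<union> set us) \<union> \<Union> (tvars ` set ts) \<subseteq> {..<M}"
    using finite_nat_set_iff_bounded by (metis subsetI lessThan_iff)
  define \<sigma>' where "\<sigma>' x = (if x \<in> set xs then x + M else \<sigma> x)" for x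
  have "change D T \<subseteq> {..<M}" using change_subset[of D T] vars_Skip[of D T] M by auto
  then have "x + M \<notin> change D T" for x by auto
  then have "admissible D T us \<sigma>'"
    using adm xs unfolding admissible_def by (auto simp: \<sigma>'_def)
  moreover have "map \<sigma>' us = map \<sigma> us" using us xs by (auto simp: \<sigma>'_def)
  ultimately have der: "derivable L I D False \<Psi> (And (rename \<sigma>' p) (equate (map \<sigma> us) ts)) T (rename \<sigma>' q)"
    using adaptsD[OF ad] by metis
  have q: "\<sigma>' x = \<sigma> x" if "x \<in> free q" for x using that xs by (auto simp: \<sigma>'_def)
  then have "free (rename \<sigma>' q) = \<sigma> ` free q" by (auto simp: free_rename)
  then have "derivable L I D False \<Psi>
      (foldr Ex (map (\<lambda>x. x + M) xs) (And (rename \<sigma>' p) (equate (map \<sigma> us) ts))) T (rename \<sigma>' q)"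
    using M by (intro derivable.Ex_Introduction[OF der]) auto
  then show "derivable L I D False \<Psi>
      (And (rename \<sigma> (foldr Ex xs p)) (equate (map \<sigma> us) ts)) T (rename \<sigma> q)"
  proof (rule derivable_consequence)
    show "is_assn L (And (rename \<sigma> (foldr Ex xs p)) (equate (map \<sigma> us) ts))" "is_assn L (rename \<sigma> q)"
      using assn us by (auto simp: is_assn_rename is_assn_equate)
  next
    fix e assume h: "holds I e (And (rename \<sigma> (foldr Ex xs p)) (equate (map \<sigma> us) ts))"
    then obtain e' where e': "\<forall>y. y \<notin> set xs \<longrightarrow> e' y = e (\<sigma> y)" "holds I e' p"
      by (auto simp: holds_rename holds_foldr_Ex)
    \<comment> \<open>This environment stores the witnesses for \<open>xs\<close> in the fresh
      copies and keeps \<open>e\<close> elsewhere, so \<open>ts\<close> and the renamed parameters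
      keep their values.\<close>
    define e'' where "e'' v = (if v \<in> (\<lambda>x. x + M) ` set xs then e' (v - M) else e v)" for v
    have low: "e'' v = e v" if "v < M" for v using that by (auto simp: e''_def)
    have "holds I (\<lambda>x. e'' (\<sigma>' x)) p = holds I e' p"
    proof (rule holds_cong)
      fix x assume "x \<in> free p"
      then have "\<sigma> x < M" using M by auto
      then show "e'' (\<sigma>' x) = e' x" using e'(1) low by (auto simp: \<sigma>'_def e''_def)
    qed
    moreover have "map e'' (map \<sigma> us) = map e (map \<sigma> us)" using M low by auto
    moreover have "map (teval I e'') ts = map (teval I e) ts"
      by (rule map_cong[OF refl], rule teval_cong) (use M low in auto)
    ultimately have "holds I e'' (And (rename \<sigma>' p) (equate (map \<sigma> us) ts))"
      using h e'(2) us(2) by (simp add: holds_rename holds_equate del: map_map map_eq_conv)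
    then show "holds I e (foldr Ex (map (\<lambda>x. x + M) xs) (And (rename \<sigma>' p) (equate (map \<sigma> us) ts)))"
      unfolding holds_foldr_Ex by (intro exI[of _ e'']) (auto simp: e''_def)
  next
    fix e assume "holds I e (rename \<sigma>' q)"
    moreover have "holds I (\<lambda>x. e (\<sigma>' x)) q = holds I (\<lambda>x. e (\<sigma> x)) q"
      by (rule holds_cong) (use q in auto)
    ultimately show "holds I e (rename \<sigma> q)" by (simp add: holds_rename)
  qed
qed

lemma adapts_consequence:
  assumes ad: "adapts L I D \<Psi> us ts T p q"
    and "\<And>e. holds I e p' \<Longrightarrow> holds I e p" and "\<And>e. holds I e q \<Longrightarrow> holds I e q'"
    and us: "length ts = length us" "list_all (is_expr L) ts"
    and assn: "is_assn L p'" "is_assn L q'"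
  shows "adapts L I D \<Psi> us ts T p' q'"
  unfolding adapts_def
proof (intro allI impI)
  fix \<sigma> assume "admissible D T us \<sigma>"
  from adaptsD[OF ad this]
  show "derivable L I D False \<Psi> (And (rename \<sigma> p') (equate (map \<sigma> us) ts)) T (rename \<sigma> q')"
    by (rule derivable_consequence)
      (use assms in \<open>auto simp: is_assn_rename is_assn_equate holds_rename\<close>)
qed

text \<open>Generic calls and blocks with identity initialization share the adaptation rules, so one
  induction treats both; the last two premises carry what differs, the assumptions and the rule
  BLOCK. Equality of the changed variables of \<open>S\<close> and \<open>T\<close> transfers the
  side conditions of SUBSTITUTION and INVARIANCE.\<close>

lemma adapts_induct:
  assumes "derivable L I D rc \<Gamma> p S q" and "\<not> rc"
    and S: "S = Call P (map Var us) \<or> S = Block us (map Var us) B" and "assn_triples L \<Gamma>"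
    and fin: "finite D" and decl: "(P, us, B) \<in> D"
    and unique: "\<And>us' B'. (P, us', B') \<in> D \<Longrightarrow> us' = us"
    and ch: "change D S = change D T"
    and len: "length ts = length us" and ex: "list_all (is_expr L) ts"
    and "\<And>a b. (a, S, b) \<in> \<Gamma> \<Longrightarrow> adapts L I D \<Psi> us ts T a b"
    and "\<And>a b. S = Block us (map Var us) B \<Longrightarrow> set us \<inter> free b = {} \<Longrightarrow>
       derivable L I D False \<Gamma> a (Seq (Assign us (map Var us)) B) b \<Longrightarrow> adapts L I D \<Psi> us ts T a b"
  shows "adapts L I D \<Psi> us ts T p q"
proof -
  have us: "set us \<subseteq> vars D Skip" using decl by (force simp: vars_def)
  have vS: "vars D Skip \<subseteq> vars D S'" for S' using vars_Skip[of D S'] by blast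
  from assms(1,2) S assms(4) ch assms(11,12) show ?thesis
  proof (induction rule: derivable.induct)
    case (Substitution rc \<Phi> p S q xs ys)
    have "is_assn L p" "is_assn L q"
      using derivable_is_assn[OF Substitution.hyps(1) Substitution.prems(3)] by auto
    moreover have "adapts L I D \<Psi> us ts T p q" by (rule Substitution.IH) (use Substitution in auto)
    ultimately show ?case
      using Substitution vS[of S] by (intro adapts_substitution us len ex) auto
  next
    case (Invariance rc \<Phi> r S q p)
    have "is_assn L r" "is_assn L q"
      using derivable_is_assn[OF Invariance.hyps(1) Invariance.prems(3)] by auto
    moreover have "adapts L I D \<Psi> us ts T r q" by (rule Invariance.IH) (use Invariance in auto)
    ultimately show ?case
      using Invariance by (intro adapts_invariance us len ex) auto
  next
    case (Ex_Introduction rc \<Phi> p S q xs)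
    have "is_assn L p" "is_assn L q"
      using derivable_is_assn[OF Ex_Introduction.hyps(1) Ex_Introduction.prems(3)] by auto
    moreover have "adapts L I D \<Psi> us ts T p q"
      by (rule Ex_Introduction.IH) (use Ex_Introduction in auto)
    ultimately show ?case
      using Ex_Introduction vS[of S] by (intro adapts_Ex us len ex fin) auto
  next
    case (Consequence p q p1 rc \<Phi> S q1)
    have "adapts L I D \<Psi> us ts T p1 q1" by (rule Consequence.IH) (use Consequence in auto)
    then show ?case
      by (rule adapts_consequence) (use Consequence len ex in \<open>auto simp: true_in_def\<close>)
  next
    \<comment> \<open>Here PROCEDURE CALL leads from the generic call to itself and substitutes
      \<open>us\<close> for \<open>us\<close>, so CONSEQUENCE suffices.\<close>
    case (Procedure_Call rc \<Phi> p P' us' q B' ts')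
    then have eq: "P' = P" "ts' = map Var us" "us' = us" using unique by auto
    have "is_assn L p" "is_assn L q"
      using derivable_is_assn[OF Procedure_Call.hyps(1) Procedure_Call.prems(3)] by auto
    moreover have "adapts L I D \<Psi> us ts T p q"
      by (rule Procedure_Call.IH) (use Procedure_Call eq in auto)
    ultimately show ?case unfolding eq
      by (elim adapts_consequence[OF _ _ _ len ex]) (simp_all add: is_assn_subst holds_subst)
  next
    case (Block rc \<Phi> p xs tl S q)
    have eq: "xs = us" "tl = map Var us" "S = B" "rc = False"
      using Block.prems(1,2) by simp_all
    show ?case
      by (rule Block.prems(6)) (use Block.hyps in \<open>simp_all only: eq\<close>)
  next
    case (Assumption p S q \<Phi> rc)
    then show ?case by blast
  qed blast+
qed

section \<open>Elimination of RECURSION II and of generic calls\<close>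

lemma finite_stmt_calls [simp]: "finite (stmt_calls S)"
  by (induction S) auto

lemma finite_calls: "finite D \<Longrightarrow> finite (calls D S)"
  by (auto simp: calls_def)

text \<open>The premises of PROCEDURE CALL and the triples of \<open>\<Phi>\<close> concern these
  calls, which need not occur in the program.\<close>

definition generic_calls :: "('p, 'f, 'r) decl set \<Rightarrow> ('p \<times> 'f tm list) set" where
  "generic_calls D = {(P, map Var us) |P us B. (P, us, B) \<in> D}"

text \<open>The block premises of RECURSION II, but with \<open>X\<close> as a mere upper bound for
  the calls. This survives unions, whereas the rule requires exactly the calls of the
  program.\<close>

definition self_supporting where
  "self_supporting L I D X \<Gamma> \<longleftrightarrow> assn_triples L \<Gamma> \<and> (\<forall>a P ts b. (a, Call P ts, b) \<in> \<Gamma> \<longrightarrow>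
     (P, ts) \<in> X \<and> (\<exists>us B. (P, us, B) \<in> D \<and> derivable L I D False \<Gamma> a (Block us ts B) b))"

lemma self_supporting_UN:
  assumes "\<And>i. i \<in> A \<Longrightarrow> self_supporting L I D X (G i)"
  shows "self_supporting L I D X (\<Union>i \<in> A. G i)"
  unfolding self_supporting_def
proof (intro conjI allI impI)
  show "assn_triples L (\<Union>i \<in> A. G i)"
    using assms unfolding self_supporting_def assn_triples_def by blast
next
  fix a P ts b assume "(a, Call P ts, b) \<in> (\<Union>i \<in> A. G i)"
  then obtain i where i: "i \<in> A" "(a, Call P ts, b) \<in> G i" by blast
  then show "(P, ts) \<in> X" using assms[OF i(1)] by (simp add: self_supporting_def)
  from i obtain us B where "(P, us, B) \<in> D" "derivable L I D False (G i) a (Block us ts B) b"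
    using assms[OF i(1)] unfolding self_supporting_def by blast
  moreover have "G i \<subseteq> (\<Union>i \<in> A. G i)" using i(1) by blast
  ultimately show "\<exists>us B. (P, us, B) \<in> D \<and> derivable L I D False (\<Union>i \<in> A. G i) a (Block us ts B) b"
    by (blast intro: derivable_mono)
qed

lemma self_supporting_Un:
  assumes "self_supporting L I D X \<Gamma>" and "self_supporting L I D X \<Gamma>'"
  shows "self_supporting L I D X (\<Gamma> \<union> \<Gamma>')"
  using self_supporting_UN[of "{\<Gamma>, \<Gamma>'}" L I D X "\<lambda>G. G"] assms by auto

text \<open>Since RECURSION II discards the assumptions of its conclusion, the assumptions of all its
  uses in a derivation can be collected.\<close>

lemma collect_recursion_assumptions:
  assumes "derivable L I D rc \<Phi> p S q" and "stmt_calls S \<subseteq> X"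
    and "calls D Skip \<subseteq> X" and "generic_calls D \<subseteq> X"
  shows "\<exists>G. finite G \<and> self_supporting L I D X G \<and> derivable L I D False (\<Phi> \<union> G) p S q"
  using assms(1,2)
proof (induction rule: derivable.induct)
  \<comment> \<open>The set \<open>\<Psi>\<close> of the rule is itself the witness: its premises
    already exclude RECURSION II, so no nested use remains to be collected.\<close>
  case (Recursion_II S P t k u B ps qs \<Psi> p q \<Phi>)
  have "calls D S \<subseteq> X" using Recursion_II.prems assms(3) by (auto simp: calls_def)
  moreover have "\<forall>i \<in> {1..k}. derivable L I D False \<Psi> (ps i) (Block (u i) (t i) (B i)) (qs i)"
    using Recursion_II.IH by blast
  ultimately have "self_supporting L I D X \<Psi>"
    unfolding self_supporting_def assn_triples_def
    using Recursion_II.hyps(1,2,3) by blast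
  moreover have "finite \<Psi>" using Recursion_II.hyps(3) by simp
  moreover have "derivable L I D False (\<Phi> \<union> \<Psi>) p S q"
    using Recursion_II.hyps(4) by (rule derivable_mono) simp
  ultimately show ?case by blast
next
  case (Composition rc \<Phi> p S1 r S2 q)
  then obtain G1 G2 where "finite G1" "self_supporting L I D X G1" "derivable L I D False (\<Phi> \<union> G1) p S1 r"
    "finite G2" "self_supporting L I D X G2" "derivable L I D False (\<Phi> \<union> G2) r S2 q"
    by auto
  then show ?case
    by (intro exI[of _ "G1 \<union> G2"] conjI self_supporting_Un derivable.Composition[where r = r])
      (auto elim!: derivable_mono)
next
  case (Conditional rc \<Phi> p b S1 q S2)
  then obtain G1 G2 where "finite G1" "self_supporting L I D X G1"
    "derivable L I D False (\<Phi> \<union> G1) (And p b) S1 q"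
    "finite G2" "self_supporting L I D X G2" "derivable L I D False (\<Phi> \<union> G2) (And p (Neg b)) S2 q"
    by auto
  then show ?case
    by (intro exI[of _ "G1 \<union> G2"] conjI self_supporting_Un derivable.Conditional)
      (auto elim!: derivable_mono)
next
  case (Procedure_Call rc \<Phi> p P us q B ts)
  then have "stmt_calls (Call P (map Var us)) \<subseteq> X"
    using assms(4) unfolding generic_calls_def by (simp only: stmt_calls.simps) blast
  with Procedure_Call show ?case by (meson derivable.Procedure_Call)
next
  case (Assumption p S q \<Phi> rc)
  then show ?case
    by (intro exI[of _ "{}"]) (auto simp: self_supporting_def assn_triples_def intro: derivable.Assumption)
next
  case (Skip p rc \<Phi>)
  then show ?case
    by (intro exI[of _ "{}"]) (auto simp: self_supporting_def assn_triples_def intro: derivable.Skip)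
next
  case (Parallel_Assignment p xs ts rc \<Phi>)
  then show ?case
    by (intro exI[of _ "{}"])
      (auto simp: self_supporting_def assn_triples_def intro: derivable.Parallel_Assignment)
next
  case (Loop rc \<Phi> p b S)
  then show ?case by (auto intro: derivable.Loop)
next
  case (Block rc \<Phi> p xs ts S q)
  then show ?case by (auto intro: derivable.Block)
next
  case (Substitution rc \<Phi> p S q xs ys)
  then show ?case by (meson derivable.Substitution)
next
  case (Invariance rc \<Phi> r S q p)
  then show ?case by (meson derivable.Invariance)
next
  case (Ex_Introduction rc \<Phi> p S q xs)
  then show ?case by (meson derivable.Ex_Introduction)
next
  case (Consequence p q p1 rc \<Phi> S q1)
  then show ?case by (meson derivable.Consequence)
qed

text \<open>The indices of the rule enumerate triples, not calls, so a call may carry several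
  assumptions. Self-support confines the calls to those of the program, and \<open>cover\<close>
  ensures that none is missed.\<close>

lemma recursion_II_finite:
  fixes \<Psi> :: "('p, 'f, 'r) triple set"
  assumes "finite \<Psi>" and "self_supporting L I D (calls D S) \<Psi>"
    and cover: "\<And>P ts. (P, ts) \<in> calls D S \<Longrightarrow> \<exists>a b. (a, Call P ts, b) \<in> \<Psi>"
    and "derivable L I D False \<Psi> p S q"
  shows "derivable L I D True \<Phi> p S q"
proof -
  obtain h where h: "bij_betw h {1..card \<Psi>} \<Psi>"
    using ex_bij_betw_nat_finite_1[OF assms(1)] by blast
  define a where "a i = fst (h i)" for i
  define b where "b i = snd (snd (h i))" for i
  have "\<forall>i \<in> {1..card \<Psi>}. \<exists>P ts us B. h i = (a i, Call P ts, b i) \<and> is_assn L (a i) \<and> is_assn L (b i) \<and>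
      (P, ts) \<in> calls D S \<and> (P, us, B) \<in> D \<and> derivable L I D False \<Psi> (a i) (Block us ts B) (b i)"
  proof
    fix i assume "i \<in> {1..card \<Psi>}"
    then have "h i \<in> \<Psi>" using h bij_betwE by blast
    moreover have "h i = (a i, fst (snd (h i)), b i)" by (simp add: a_def b_def)
    ultimately have mem: "(a i, fst (snd (h i)), b i) \<in> \<Psi>" by simp
    have "assn_triples L \<Psi>" using assms(2) by (simp add: self_supporting_def)
    from assn_triplesD[OF this mem] obtain P ts where
      "is_assn L (a i)" "is_assn L (b i)" "fst (snd (h i)) = Call P ts"
      by blast
    then show "\<exists>P ts us B. h i = (a i, Call P ts, b i) \<and> is_assn L (a i) \<and> is_assn L (b i) \<and>
      (P, ts) \<in> calls D S \<and> (P, us, B) \<in> D \<and> derivable L I D False \<Psi> (a i) (Block us ts B) (b i)"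
      using mem assms(2) \<open>h i = (a i, fst (snd (h i)), b i)\<close>
      unfolding self_supporting_def by metis
  qed
  then obtain P ts us B where *: "\<forall>i \<in> {1..card \<Psi>}. h i = (a i, Call (P i) (ts i), b i) \<and>
      is_assn L (a i) \<and> is_assn L (b i) \<and> (P i, ts i) \<in> calls D S \<and> (P i, us i, B i) \<in> D \<and>
      derivable L I D False \<Psi> (a i) (Block (us i) (ts i) (B i)) (b i)"
    by metis
  have "h ` {1..card \<Psi>} = (\<lambda>i. (a i, Call (P i) (ts i), b i)) ` {1..card \<Psi>}"
    by (rule image_cong) (use * in blast)+
  then have \<Psi>: "\<Psi> = {(a i, Call (P i) (ts i), b i) |i. i \<in> {1..card \<Psi>}}"
    unfolding Setcompr_eq_image by (rule trans[OF bij_betw_imp_surj_on[OF h, symmetric]])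
  have "calls D S = {(P i, ts i) |i. i \<in> {1..card \<Psi>}}"
  proof (rule set_eqI, clarify)
    fix Q t
    show "(Q, t) \<in> calls D S \<longleftrightarrow> (Q, t) \<in> {(P i, ts i) |i. i \<in> {1..card \<Psi>}}"
    proof
      assume "(Q, t) \<in> calls D S"
      then obtain a' b' where "(a', Call Q t, b') \<in> \<Psi>" using cover by blast
      then have "(a', Call Q t :: ('p, 'f, 'r) stmt, b') \<in>
          {(a i, Call (P i) (ts i), b i) |i. i \<in> {1..card \<Psi>}}"
        by (rule subsetD[OF equalityD1[OF \<Psi>]])
      then show "(Q, t) \<in> {(P i, ts i) |i. i \<in> {1..card \<Psi>}}" by blast
    qed (use * in blast)
  qed
  then show ?thesis
    by (rule derivable.Recursion_II[OF _ _ \<Psi>]) (use * assms(4) in auto)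
qed

section \<open>Replacing generic calls in a fixed program\<close>

text \<open>\<open>\<Gamma>\<close> will be \<open>\<Phi>\<close> together with all collected
  assumptions. A single \<open>N\<close> above all variables involved provides the fresh copies for
  all triples at once.\<close>

locale generic_elimination =
  fixes L :: "('f, 'r) lang" and I :: "('f, 'r, 'd) interp" and D :: "('p, 'f, 'r) decl set"
    and S :: "('p, 'f, 'r) stmt" and \<Gamma> :: "('p, 'f, 'r) triple set" and N :: nat
  assumes program: "is_program L D S"
    and finite_\<Gamma>: "finite \<Gamma>"
    and supp: "self_supporting L I D (calls D S \<union> generic_calls D) \<Gamma>"
    and bound: "vars D S \<subseteq> {..<N}" "\<And>a C b. (a, C, b) \<in> \<Gamma> \<Longrightarrow> free a \<union> free b \<subseteq> {..<N}"
begin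

abbreviation \<rho> where "\<rho> us \<equiv> fresh_renaming D N us"

text \<open>The second part retains the assumptions on calls that do occur in the program, since
  derivations may use them as they stand.\<close>

definition \<Psi> :: "('p, 'f, 'r) triple set" where
  "\<Psi> = {(And (rename (\<rho> us) a) (equate (map (\<rho> us) us) ts), Call P ts, rename (\<rho> us) b) |a b P us B ts.
         (a, Call P (map Var us), b) \<in> \<Gamma> \<and> (P, us, B) \<in> D \<and> (P, ts) \<in> calls D S} \<union>
       {(a, Call P ts, b) |a P ts b. (a, Call P ts, b) \<in> \<Gamma> \<and> (P, ts) \<in> calls D S}"

lemma finite_D: "finite D"
  using program by (simp add: is_program_def)

lemma unique: "(P, us, B) \<in> D \<Longrightarrow> (P, us', B') \<in> D \<Longrightarrow> us' = us \<and> B' = B"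
proof -
  assume decl: "(P, us, B) \<in> D" "(P, us', B') \<in> D"
  then have "P \<in> fst ` D \<union> fst ` calls D S" by force
  then have "\<exists>!d. d \<in> D \<and> fst d = P" using program unfolding is_program_def by blast
  then have "(P, us, B) = (P, us', B')" using decl by (metis fst_conv)
  then show "us' = us \<and> B' = B" by simp
qed

lemma distinct_params: "(P, us, B) \<in> D \<Longrightarrow> distinct us"
  using program by (auto simp: is_program_def)

lemma assn_\<Gamma>: "assn_triples L \<Gamma>"
  using supp by (simp add: self_supporting_def)

lemma wf_call:
  assumes "(P, ts) \<in> calls D S"
  shows "wf_stmt L D (Call P ts)"
proof -
  have "wf_stmt L D S" "(Q, us, B) \<in> D \<Longrightarrow> wf_stmt L D B" for Q us B
    using program by (auto simp: is_program_def)
  moreover have "(P, ts) \<in> stmt_calls S \<or> (\<exists>Q us B. (Q, us, B) \<in> D \<and> (P, ts) \<in> stmt_calls B)"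
    using assms by (auto simp: calls_def)
  ultimately show ?thesis using wf_stmt_calls by metis
qed

lemma call_args:
  assumes "(P, us, B) \<in> D" and "(P, ts) \<in> calls D S"
  shows "length ts = length us" and "list_all (is_expr L) ts"
  using wf_call[OF assms(2)] assms(1) by auto

lemma tvars_args: "(P, ts) \<in> calls D S \<Longrightarrow> \<Union> (tvars ` set ts) \<subseteq> vars D S"
proof -
  assume "(P, ts) \<in> calls D S"
  then have "(P, ts) \<in> stmt_calls S \<or> (\<exists>Q us B. (Q, us, B) \<in> D \<and> (P, ts) \<in> stmt_calls B)"
    by (auto simp: calls_def)
  moreover have "(P, ts) \<in> stmt_calls B \<Longrightarrow> \<Union> (tvars ` set ts) \<subseteq> stmt_vars B"
    for B :: "('p, 'f, 'r) stmt"
    by (induction B) auto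
  ultimately show "\<Union> (tvars ` set ts) \<subseteq> vars D S" by (fastforce simp: vars_def)
qed

lemma decl_vars: "(P, us, B) \<in> D \<Longrightarrow> set us \<union> stmt_vars B \<subseteq> vars D Skip"
  by (force simp: vars_def)

lemma change_Call: "change D (Call P ts) \<subseteq> vars D Skip"
  using change_decls_subset[of D] by (auto simp: change_def)

text \<open>An assumption on the generic call has its translation in \<open>\<Psi>\<close>, which
  \<open>adapts_fresh\<close> spreads to all admissible renamings; \<open>adapts_induct\<close>
  repeats the rest of the derivation.\<close>

lemma call_adapts:
  assumes "derivable L I D False \<Gamma> p (Call P (map Var us)) q"
    and decl: "(P, us, B) \<in> D" and call: "(P, ts) \<in> calls D S"
  shows "adapts L I D \<Psi> us ts (Call P ts) p q"
proof (rule adapts_induct[OF assms(1), of P us B])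
  fix a b assume mem: "(a, Call P (map Var us), b) \<in> \<Gamma>"
  show "adapts L I D \<Psi> us ts (Call P ts) a b"
  proof (rule adapts_fresh[where N = N])
    show "derivable L I D False \<Psi> (And (rename (\<rho> us) a) (equate (map (\<rho> us) us) ts)) (Call P ts)
        (rename (\<rho> us) b)"
      by (rule derivable.Assumption) (use mem decl call in \<open>auto simp: \<Psi>_def\<close>)
    show "free a \<union> free b \<union> vars D (Call P ts) \<union> set us \<union> \<Union> (tvars ` set ts) \<subseteq> {..<N}"
      using bound(1) bound(2)[OF mem] tvars_args[OF call] decl_vars[OF decl] vars_Skip[of D S]
        vars_Skip[of D "Call P ts"] by auto
  qed (use assn_triplesD[OF assn_\<Gamma> mem] call_args[OF decl call] in auto)
next
  show "change D (Call P (map Var us)) = change D (Call P ts)" by (simp add: change_def)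
qed (use assn_\<Gamma> finite_D unique[OF decl] decl call_args[OF decl call] in blast)+

text \<open>The parameters are renamed to fresh variables, tied to \<open>ts\<close> by the
  equation, and then quantified. The postcondition is unaffected because it mentions no formal
  parameter.\<close>

lemma procedure_call:
  assumes der: "derivable L I D False \<Gamma> p (Call P (map Var us)) q"
    and decl: "(P, us, B) \<in> D" and call: "(P, ts) \<in> calls D S" and us: "set us \<inter> free q = {}"
  shows "derivable L I D False \<Psi> (p[us :=\<^sub>s ts]) (Call P ts) q"
proof -
  note args = call_args[OF decl call]
  have assn: "is_assn L p" "is_assn L q" using derivable_is_assn[OF der assn_\<Gamma>] by auto
  have "finite (vars D (Call P ts) \<union> free p \<union> free q \<union> \<Union> (tvars ` set ts))"
    using finite_vars[OF finite_D] by simp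
  then obtain M where M: "vars D (Call P ts) \<union> free p \<union> free q \<union> \<Union> (tvars ` set ts) \<subseteq> {..<M}"
    using finite_nat_set_iff_bounded by (metis subsetI lessThan_iff)
  \<comment> \<open>Only the parameters move. Variables outside the declarations may stay, because a
    call changes none of them.\<close>
  define \<sigma> where "\<sigma> x = (if x \<in> set us then x + M else x)" for x
  have "change D (Call P ts) \<subseteq> {..<M}"
    using change_Call vars_Skip[of D "Call P ts"] M by blast
  then have "x + M \<notin> change D (Call P ts)" for x by auto
  then have "admissible D (Call P ts) us \<sigma>"
    using change_Call by (auto simp: admissible_def \<sigma>_def)
  then have der': "derivable L I D False \<Psi> (And (rename \<sigma> p) (equate (map \<sigma> us) ts)) (Call P ts) (rename \<sigma> q)"
    using adaptsD call_adapts[OF der decl call] by blast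
  have q: "\<sigma> x = x" if "x \<in> free q" for x using that us by (auto simp: \<sigma>_def)
  then have "free (rename \<sigma> q) = free q" by (auto simp: free_rename)
  moreover have "set (map \<sigma> us) \<inter> {..<M} = {}" by (auto simp: \<sigma>_def)
  ultimately have "derivable L I D False \<Psi> (foldr Ex (map \<sigma> us) (And (rename \<sigma> p) (equate (map \<sigma> us) ts)))
      (Call P ts) (rename \<sigma> q)"
    using M by (intro derivable.Ex_Introduction[OF der']) blast
  then show ?thesis
  proof (rule derivable_consequence)
    show "is_assn L (p[us :=\<^sub>s ts])"
      using assn args by (simp add: is_assn_subst is_expr_assign_subst)
  next
    fix e assume h: "holds I e (p[us :=\<^sub>s ts])"
    \<comment> \<open>The quantified copies receive the values of the actual parameters; subtracting
      \<open>M\<close> recovers a formal parameter from its copy.\<close>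
    define e' where "e' v = (if v \<in> set (map \<sigma> us) then teval I e (assign_subst us ts (v - M)) else e v)" for v
    have low: "e' v = e v" if "v < M" for v using that by (auto simp: e'_def \<sigma>_def)
    have param: "e' (\<sigma> x) = teval I e (assign_subst us ts x)" if "x \<in> set us" for x
      using that by (auto simp: e'_def \<sigma>_def)
    have "holds I (\<lambda>x. e' (\<sigma> x)) p = holds I (\<lambda>x. teval I e (assign_subst us ts x)) p"
    proof (rule holds_cong)
      fix x assume "x \<in> free p"
      then have "x < M" using M by auto
      then show "e' (\<sigma> x) = teval I e (assign_subst us ts x)"
        using param low by (cases "x \<in> set us") (auto simp: \<sigma>_def assign_subst_outside)
    qed
    moreover have "map e' (map \<sigma> us) = map (teval I e') ts"
    proof (rule nth_equalityI)
      fix i assume "i < length (map e' (map \<sigma> us))"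
      then have i: "i < length us" by simp
      have "teval I e' (ts ! i) = teval I e (ts ! i)"
        by (rule teval_cong, rule low) (use M i args(1) nth_mem[of i ts] in fastforce)
      then show "map e' (map \<sigma> us) ! i = map (teval I e') ts ! i"
        using i args(1) param[of "us ! i"] assign_subst_distinct[OF distinct_params[OF decl] args(1) i]
        by simp
    qed (simp add: args)
    ultimately have "holds I e' (And (rename \<sigma> p) (equate (map \<sigma> us) ts))"
      using h args(1) by (simp add: holds_subst holds_equate del: map_map)
    then show "holds I e (foldr Ex (map \<sigma> us) (And (rename \<sigma> p) (equate (map \<sigma> us) ts)))"
      unfolding holds_foldr_Ex by (intro exI[of _ e']) (simp add: e'_def)
  next
    fix e assume "holds I e (rename \<sigma> q)"
    moreover have "holds I (\<lambda>x. e (\<sigma> x)) q = holds I e q"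
      by (rule holds_cong) (use q in auto)
    ultimately show "holds I e q" by (simp add: holds_rename)
  qed (rule assn)
qed

text \<open>Only PROCEDURE CALL has a premise on a call that may lie outside the program;
  \<open>procedure_call\<close> replaces the whole derivation of that premise. The other rules are
  replayed, assumptions being found in the second part of \<open>\<Psi>\<close>.\<close>

lemma derivable_without_generic:
  "derivable L I D rc \<Gamma>' p T q \<Longrightarrow> \<not> rc \<Longrightarrow> \<Gamma>' = \<Gamma> \<Longrightarrow> stmt_calls T \<subseteq> calls D S \<Longrightarrow>
   derivable L I D False \<Psi> p T q"
proof (induction rule: derivable.induct)
  case (Assumption p T q \<Phi> rc)
  then obtain P ts where "T = Call P ts" using assn_triplesD[OF assn_\<Gamma>] by blast
  with Assumption show ?case by (intro derivable.Assumption) (auto simp: \<Psi>_def)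
next
  case (Procedure_Call rc \<Phi> p P us q B ts)
  then show ?case by (intro procedure_call) auto
next
  case (Substitution rc \<Phi> p S q xs ys)
  then show ?case by (simp add: derivable.Substitution)
next
  case (Invariance rc \<Phi> r S q p)
  then show ?case by (simp add: derivable.Invariance)
next
  case (Ex_Introduction rc \<Phi> p S q xs)
  then show ?case by (simp add: derivable.Ex_Introduction)
next
  case (Consequence p q p1 rc \<Phi> S q1)
  then show ?case by (meson derivable.Consequence)
qed (auto intro: derivable.Skip derivable.Parallel_Assignment derivable.Composition
    derivable.Conditional derivable.Loop derivable.Block)

text \<open>Below BLOCK, the initialization \<open>us := us\<close> is removed, which leaves a
  derivation for the body, and the initialization by \<open>ts\<close> is put in front. The
  adaptation rules after BLOCK are left to \<open>adapts_induct\<close>.\<close>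

lemma block_adapts:
  assumes "derivable L I D False \<Gamma> p (Block us (map Var us) B) q"
    and decl: "(P, us, B) \<in> D" and call: "(P, ts) \<in> calls D S"
  shows "adapts L I D \<Psi> us ts (Block us ts B) p q"
proof (rule adapts_induct[OF assms(1), of P us B])
  fix a b assume us: "set us \<inter> free b = {}"
    and der: "derivable L I D False \<Gamma> a (Seq (Assign us (map Var us)) B) b"
  note args = call_args[OF decl call]
  have assn: "is_assn L a" "is_assn L b" using derivable_is_assn[OF der assn_\<Gamma>] by auto
  have "derivable L I D False \<Gamma> a B b"
    by (rule identity_assignment_elim[OF der]) (use assn_\<Gamma> in auto)
  then have body: "derivable L I D False \<Psi> a B b"
    by (rule derivable_without_generic) (use decl in \<open>force simp: calls_def\<close>)+
  have "finite (free a \<union> free b \<union> vars D (Block us ts B) \<union> set us \<union> \<Union> (tvars ` set ts))"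
    using finite_vars[OF finite_D] by simp
  then obtain M where
    M: "free a \<union> free b \<union> vars D (Block us ts B) \<union> set us \<union> \<Union> (tvars ` set ts) \<subseteq> {..<M}"
    using finite_nat_set_iff_bounded by (metis subsetI lessThan_iff)
  let ?\<sigma> = "fresh_renaming D M us"
  \<comment> \<open>Logical variables are shifted as in \<open>?\<sigma>\<close>, but the parameters
    stay so that the assignment \<open>us := ts\<close> acts on them. On the free variables of
    \<open>a\<close> and \<open>b\<close>, the two maps differ only at parameters.\<close>
  define X where "X = (free a \<union> free b) - vars D Skip"
  define \<tau> where "\<tau> x = (if x \<in> X then x + M else x)" for x
  have varsB: "vars D B = vars D Skip" using vars_Skip[of D B] decl_vars[OF decl] by blast
  have VM: "vars D Skip \<subseteq> {..<M}" using M vars_Skip[of D "Block us ts B"] by blast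
  have "change D B \<subseteq> {..<M}" using change_subset[of D B] varsB vars_Skip[of D B] VM by blast
  then have "derivable L I D False \<Psi> (rename \<tau> a) B (rename \<tau> b)"
    by (intro derivable_rename[OF body, of X]) (auto simp: X_def varsB \<tau>_def)
  moreover have "derivable L I D False \<Psi> ((rename \<tau> a)[us :=\<^sub>s ts]) (Assign us ts) (rename \<tau> a)"
    by (rule derivable.Parallel_Assignment)
      (use assn args distinct_params[OF decl] in \<open>auto simp: is_assn_rename\<close>)
  ultimately have "derivable L I D False \<Psi> ((rename \<tau> a)[us :=\<^sub>s ts]) (Seq (Assign us ts) B) (rename \<tau> b)"
    by (rule derivable.Composition[rotated])
  moreover have high: "x + M \<notin> set us" for x using M by auto
  have "set us \<inter> free (rename \<tau> b) = {}"
    using us high by (auto simp: free_rename \<tau>_def split: if_splits)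
  ultimately have blk: "derivable L I D False \<Psi> ((rename \<tau> a)[us :=\<^sub>s ts]) (Block us ts B) (rename \<tau> b)"
    by (rule derivable.Block)
  show "adapts L I D \<Psi> us ts (Block us ts B) a b"
  proof (rule adapts_fresh[where N = M])
    show "derivable L I D False \<Psi> (And (rename ?\<sigma> a) (equate (map ?\<sigma> us) ts)) (Block us ts B) (rename ?\<sigma> b)"
      using blk
    proof (rule derivable_consequence)
      show "is_assn L (And (rename ?\<sigma> a) (equate (map ?\<sigma> us) ts))" "is_assn L (rename ?\<sigma> b)"
        using assn args by (auto simp: is_assn_rename is_assn_equate)
    next
      fix e assume h: "holds I e (And (rename ?\<sigma> a) (equate (map ?\<sigma> us) ts))"
      then have eq: "map e (map ?\<sigma> us) = map (teval I e) ts"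
        using args(1) by (simp add: holds_equate del: map_map)
      have "holds I (\<lambda>x. teval I e (assign_subst us ts (\<tau> x))) a = holds I (\<lambda>x. e (?\<sigma> x)) a"
      proof (rule holds_cong)
        fix x assume x: "x \<in> free a"
        show "teval I e (assign_subst us ts (\<tau> x)) = e (?\<sigma> x)"
        proof (cases "x \<in> set us")
          case True
          then have "\<tau> x = x" using decl_vars[OF decl] by (auto simp: \<tau>_def X_def)
          then show ?thesis using teval_assign_subst_equate[OF args(1) eq True] by simp
        next
          case False
          then have "\<tau> x = ?\<sigma> x" "\<tau> x \<notin> set us"
            using x high by (auto simp: \<tau>_def X_def fresh_renaming_def)
          then show ?thesis by (simp add: assign_subst_outside)
        qed
      qed
      with h show "holds I e ((rename \<tau> a)[us :=\<^sub>s ts])" by (simp add: holds_subst)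
    next
      fix e assume "holds I e (rename \<tau> b)"
      moreover have "holds I (\<lambda>x. e (\<tau> x)) b = holds I (\<lambda>x. e (?\<sigma> x)) b"
        by (rule holds_cong) (use us in \<open>auto simp: \<tau>_def X_def fresh_renaming_def\<close>)
      ultimately show "holds I e (rename ?\<sigma> b)" by (simp add: holds_rename)
    qed
  qed (use M args assn in auto)
next
  show "change D (Block us (map Var us) B) = change D (Block us ts B)" by (simp add: change_def)
next
  show "adapts L I D \<Psi> us ts (Block us ts B) a b" if "(a, Block us (map Var us) B, b) \<in> \<Gamma>" for a b
    using assn_triplesD[OF assn_\<Gamma> that] by simp
qed (use assn_\<Gamma> finite_D unique[OF decl] decl call_args[OF decl call] in blast)+

text \<open>A translated triple is an instance of \<open>block_adapts\<close> at
  \<open>\<rho>\<close>, starting from the block that supports the generic triple in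
  \<open>\<Gamma>\<close>. A retained triple gets its block derivation from
  \<open>derivable_without_generic\<close>.\<close>

lemma self_supporting_\<Psi>: "self_supporting L I D (calls D S) \<Psi>"
  unfolding self_supporting_def
proof (intro conjI allI impI)
  show "assn_triples L \<Psi>"
    unfolding assn_triples_def \<Psi>_def using assn_triplesD[OF assn_\<Gamma>] call_args
    by (auto simp: is_assn_rename is_assn_equate)
next
  fix a P ts b assume "(a, Call P ts, b) \<in> \<Psi>"
  then show "(P, ts) \<in> calls D S" by (auto simp: \<Psi>_def)
next
  fix a P ts b assume "(a, Call P ts, b) \<in> \<Psi>"
  then consider
    (translated) a' b' us B where "a = And (rename (\<rho> us) a') (equate (map (\<rho> us) us) ts)"
      "b = rename (\<rho> us) b'" "(a', Call P (map Var us), b') \<in> \<Gamma>" "(P, us, B) \<in> D" "(P, ts) \<in> calls D S"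
  | (original) "(a, Call P ts, b) \<in> \<Gamma>" "(P, ts) \<in> calls D S"
    by (auto simp: \<Psi>_def)
  then show "\<exists>us B. (P, us, B) \<in> D \<and> derivable L I D False \<Psi> a (Block us ts B) b"
  proof cases
    case translated
    have "derivable L I D False \<Gamma> a' (Block us (map Var us) B) b'"
      using supp translated(3,4) unique unfolding self_supporting_def by blast
    then have ad: "adapts L I D \<Psi> us ts (Block us ts B) a' b'"
      by (rule block_adapts) (use translated in auto)
    have "stmt_vars (Block us ts B) \<union> vars D Skip \<subseteq> {..<N}"
      using decl_vars[OF translated(4)] tvars_args[OF translated(5)] bound(1) vars_Skip[of D S] by auto
    then have "change D (Block us ts B) \<subseteq> {..<N}" using change_subset[of D "Block us ts B"] by blast
    then have "x + N \<notin> change D (Block us ts B)" for x by auto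
    then have "admissible D (Block us ts B) us (\<rho> us)"
      by (auto simp: admissible_def fresh_renaming_def)
    from adaptsD[OF ad this] show ?thesis using translated by blast
  next
    case original
    then obtain us B where decl: "(P, us, B) \<in> D" and "derivable L I D False \<Gamma> a (Block us ts B) b"
      using supp unfolding self_supporting_def by blast
    then have "derivable L I D False \<Psi> a (Block us ts B) b"
      by (intro derivable_without_generic) (force simp: calls_def)+
    with decl show ?thesis by blast
  qed
qed

lemma finite_\<Psi>: "finite \<Psi>"
proof -
  let ?f = "\<lambda>((a, C, b), (P, us, B), (Q, ts)).
    (And (rename (\<rho> us) a) (equate (map (\<rho> us) us) ts), Call P ts, rename (\<rho> us) b)"
  have "\<Psi> \<subseteq> ?f ` (\<Gamma> \<times> D \<times> calls D S) \<union> \<Gamma>"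
    unfolding \<Psi>_def by (force simp: image_iff)
  then show ?thesis
    by (rule finite_subset) (simp add: finite_\<Gamma> finite_D finite_calls)
qed

lemma recursion:
  assumes cover: "\<And>P us B. (P, us, B) \<in> D \<Longrightarrow> \<exists>a b. (a, Call P (map Var us), b) \<in> \<Gamma>"
    and "derivable L I D False \<Gamma> p S q"
  shows "derivable L I D True \<Phi> p S q"
proof (rule recursion_II_finite[OF finite_\<Psi> self_supporting_\<Psi>])
  fix P ts assume call: "(P, ts) \<in> calls D S"
  then have "P \<in> fst ` calls D S" by force
  then obtain us B where decl: "(P, us, B) \<in> D"
    using program unfolding is_program_def by (metis UnI2 prod.collapse)
  then obtain a b where "(a, Call P (map Var us), b) \<in> \<Gamma>" using cover by blast
  then have "(And (rename (\<rho> us) a) (equate (map (\<rho> us) us) ts), Call P ts, rename (\<rho> us) b) \<in> \<Psi>"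
    unfolding \<Psi>_def using decl call by blast
  then show "\<exists>a b. (a, Call P ts, b) \<in> \<Psi>" by blast
next
  show "derivable L I D False \<Psi> p S q"
    by (rule derivable_without_generic[OF assms(2)]) (auto simp: calls_def)
qed

end

section \<open>Deriving RECURSION from RECURSION II\<close>

theorem theorem1:
  fixes L :: "('f, 'r) lang" and I :: "('f, 'r, 'd) interp"
    and D :: "('p, 'f, 'r) decl set" and S :: "('p, 'f, 'r) stmt"
    and n :: nat and P :: "nat \<Rightarrow> 'p" and u :: "nat \<Rightarrow> var list" and B :: "nat \<Rightarrow> ('p, 'f, 'r) stmt"
    and p q :: "('f, 'r) fm" and ps qs :: "nat \<Rightarrow> ('f, 'r) fm"
    and \<Phi> :: "('p, 'f, 'r) triple set"
  assumes "is_program L D S"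
    and "D = {(P i, u i, B i) |i. i \<in> {1..n}}"
    and "is_assn L p" and "is_assn L q"
    and "\<forall>i \<in> {1..n}. is_assn L (ps i) \<and> is_assn L (qs i)"
    and "\<forall>i \<in> {1..n}. set (u i) \<inter> free (qs i) = {}"
    and "\<Phi> = {(ps i, Call (P i) (map Var (u i)), qs i) |i. i \<in> {1..n}}"
    and "ABO1 L I D \<Phi> p S q"
    and "\<forall>i \<in> {1..n}. ABO1 L I D \<Phi> (ps i) (B i) (qs i)"
  shows "ABO1 L I D {} p S q"
proof -
  let ?X = "calls D S \<union> generic_calls D"
  have X: "calls D Skip \<subseteq> ?X" "generic_calls D \<subseteq> ?X" by (auto simp: calls_def)
  have decl: "(P i, u i, B i) \<in> D" if "i \<in> {1..n}" for i using that assms(2) by blast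
  have "stmt_calls S \<subseteq> ?X" by (auto simp: calls_def)
  then obtain G0 where G0: "finite G0" "self_supporting L I D ?X G0" "derivable L I D False (\<Phi> \<union> G0) p S q"
    using collect_recursion_assumptions[OF assms(8) _ X] by blast
  have "\<forall>i \<in> {1..n}. \<exists>G. finite G \<and> self_supporting L I D ?X G \<and>
      derivable L I D False (\<Phi> \<union> G) (ps i) (B i) (qs i)"
  proof
    fix i assume i: "i \<in> {1..n}"
    have "stmt_calls (B i) \<subseteq> ?X" using decl[OF i] by (force simp: calls_def)
    then show "\<exists>G. finite G \<and> self_supporting L I D ?X G \<and>
        derivable L I D False (\<Phi> \<union> G) (ps i) (B i) (qs i)"
      by (rule collect_recursion_assumptions[OF bspec[OF assms(9) i] _ X])
  qed
  then obtain G where G: "\<And>i. i \<in> {1..n} \<Longrightarrow> finite (G i) \<and> self_supporting L I D ?X (G i) \<and>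
      derivable L I D False (\<Phi> \<union> G i) (ps i) (B i) (qs i)"
    by metis
  define H where "H = G0 \<union> (\<Union>i \<in> {1..n}. G i)"
  define \<Gamma> where "\<Gamma> = \<Phi> \<union> H"
  have H: "self_supporting L I D ?X H"
    unfolding H_def using G0 G by (intro self_supporting_Un self_supporting_UN) auto
  have fin: "finite \<Gamma>" unfolding \<Gamma>_def H_def using G0 G assms(7) by simp
  \<comment> \<open>Prefixing the identity assignment turns the derivation for \<open>B i\<close>
    into one for the block of the generic call; the condition on \<open>free (qs i)\<close> is the
    side condition of BLOCK. This makes the triples of \<open>\<Phi>\<close> supported.\<close>
  have body: "derivable L I D False \<Gamma> (ps i) (Block (u i) (map Var (u i)) (B i)) (qs i)"
    if i: "i \<in> {1..n}" for i
  proof (rule derivable.Block[OF derivable.Composition[where r = "ps i"]])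
    show "derivable L I D False \<Gamma> (ps i) (B i) (qs i)"
      using G[OF i] by (elim conjE derivable_mono) (use i in \<open>auto simp: \<Gamma>_def H_def\<close>)
    have "distinct (u i)" using assms(1) decl[OF i] by (auto simp: is_program_def)
    then have "derivable L I D False \<Gamma> ((ps i)[u i :=\<^sub>s map Var (u i)])
        (Assign (u i) (map Var (u i))) (ps i)"
      by (intro derivable.Parallel_Assignment) (use assms(5) i in \<open>auto simp: list_all_iff\<close>)
    then show "derivable L I D False \<Gamma> (ps i) (Assign (u i) (map Var (u i))) (ps i)"
      by (rule derivable_consequence) (use assms(5) i in \<open>auto simp: holds_subst\<close>)
  qed (use assms(6) i in blast)
  have supp: "self_supporting L I D ?X \<Gamma>"
    unfolding self_supporting_def
  proof (intro conjI allI impI)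
    show "assn_triples L \<Gamma>"
      using H assms(5) by (auto simp: \<Gamma>_def assms(7) self_supporting_def assn_triples_def)
  next
    fix a Q ts b assume "(a, Call Q ts, b) \<in> \<Gamma>"
    then consider "(a, Call Q ts, b) \<in> H" | i where "i \<in> {1..n}" "Q = P i" "ts = map Var (u i)"
      unfolding \<Gamma>_def assms(7) by blast
    then show "(Q, ts) \<in> ?X"
    proof cases
      case 1
      then show ?thesis using H unfolding self_supporting_def by blast
    next
      case 2
      then show ?thesis using decl unfolding generic_calls_def by blast
    qed
  next
    fix a Q ts b assume "(a, Call Q ts, b) \<in> \<Gamma>"
    then consider "(a, Call Q ts, b) \<in> \<Phi>" | "(a, Call Q ts, b) \<in> H" by (auto simp: \<Gamma>_def)
    then show "\<exists>us B. (Q, us, B) \<in> D \<and> derivable L I D False \<Gamma> a (Block us ts B) b"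
    proof cases
      case 1
      then show ?thesis using body decl assms(7) by blast
    next
      case 2
      then obtain us B where "(Q, us, B) \<in> D" "derivable L I D False H a (Block us ts B) b"
        using H unfolding self_supporting_def by blast
      moreover have "H \<subseteq> \<Gamma>" by (simp add: \<Gamma>_def)
      ultimately show ?thesis using derivable_mono by blast
    qed
  qed
  have "finite (vars D S \<union> (\<Union>(a, C, b) \<in> \<Gamma>. free a \<union> free b))"
    using fin finite_vars assms(1) by (auto simp: is_program_def)
  then obtain N where N: "vars D S \<union> (\<Union>(a, C, b) \<in> \<Gamma>. free a \<union> free b) \<subseteq> {..<N}"
    using finite_nat_set_iff_bounded by (metis subsetI lessThan_iff)
  interpret generic_elimination L I D S \<Gamma> N
    using assms(1) fin supp N by unfold_locales auto
  show ?thesis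
  proof (rule recursion)
    fix Q us C assume "(Q, us, C) \<in> D"
    then show "\<exists>a b. (a, Call Q (map Var us), b) \<in> \<Gamma>" using assms(2,7) by (auto simp: \<Gamma>_def)
  next
    show "derivable L I D False \<Gamma> p S q"
      using G0(3) by (rule derivable_mono) (auto simp: \<Gamma>_def H_def)
  qed
qed

end
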